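(* The tautologies $STCONN(n)$ have polynomial size $AC^0(2)$-Frege proofs.
   Context: $STCONN(n)$ formalizes the st-connectivity principle on the $n\times n$ grid graph with paths given as edge sets: for each horizontal and vertical edge slot $e$ of the grid there are propositional variables $e_b$ ("$e$ is blue") and $e_r$ ("$e$ is red"). $STCONN(n)$ is the negation of the CNF whose clauses assert: each of the four corners has degree one; the upper-left and lower-right corners each touch blue edges; the other two corners each touch red edges; every other node has degree zero or two; and no node touches both a blue and a red edge. An $AC^0$-Frege (constant-depth Frege) system is a Frege system whose proof lines are formulas with unbounded fan-in $\wedge,\vee$ of depth bounded by a constant $d$; $AC^0(2)$-Frege extends it with unbounded fan-in parity gates $\oplus(x_1,\ldots,x_k)$ and axioms defining them. Polynomial size means proof size bounded by a polynomial in $n$ (for some fixed depth bound). *)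

theory Defs
  imports "HOL-Computational_Algebra.Polynomial"
begin

section \<open>Constant-depth Frege systems with parity gates\<close>

datatype 'v fm =
    Var 'v
  | Neg "'v fm"
  | Conj "'v fm list"
  | Disj "'v fm list"
  | Par "'v fm list"

abbreviation Imp :: "'v fm \<Rightarrow> 'v fm \<Rightarrow> 'v fm" where
  "Imp A B \<equiv> Disj [Neg A, B]"

text \<open>The depth is the height of the formula tree, with negations counted. Adjacent equal gates
  are not merged, since the unbounded fan-in allows a single gate to replace them.\<close>

primrec depth :: "'v fm \<Rightarrow> nat" where
  "depth (Var x) = 0"
| "depth (Neg A) = Suc (depth A)"
| "depth (Conj As) = Suc (fold max (map depth As) 0)"
| "depth (Disj As) = Suc (fold max (map depth As) 0)"
| "depth (Par As) = Suc (fold max (map depth As) 0)"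

primrec symbols :: "'v fm \<Rightarrow> nat" where
  "symbols (Var x) = 1"
| "symbols (Neg A) = Suc (symbols A)"
| "symbols (Conj As) = Suc (sum_list (map symbols As))"
| "symbols (Disj As) = Suc (sum_list (map symbols As))"
| "symbols (Par As) = Suc (sum_list (map symbols As))"

text \<open>A Hilbert-style Frege system whose only rule of inference is modus ponens. The first three
  schemes are Lukasiewicz's axioms for implication and negation, the others fix the meaning of the
  unbounded fan-in gates, with the values of the empty gates as base cases.\<close>

inductive AC0_axiom :: "'v fm \<Rightarrow> bool" where
  K: "AC0_axiom (Imp A (Imp B A))"
| S: "AC0_axiom (Imp (Imp A (Imp B C)) (Imp (Imp A B) (Imp A C)))"
| Contrapos: "AC0_axiom (Imp (Imp (Neg A) (Neg B)) (Imp B A))"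
| Conj_Nil: "AC0_axiom (Conj [])"
| Conj_intro: "AC0_axiom (Imp A (Imp (Conj As) (Conj (A # As))))"
| Conj_elim: "A \<in> set As \<Longrightarrow> AC0_axiom (Imp (Conj As) A)"
| Disj_Nil: "AC0_axiom (Neg (Disj []))"
| Disj_intro: "A \<in> set As \<Longrightarrow> AC0_axiom (Imp A (Disj As))"
| Disj_elim: "AC0_axiom (Imp (Disj (A # As)) (Imp (Neg A) (Disj As)))"

text \<open>The parity gate is true iff an odd number of its inputs is true.\<close>

inductive parity_axiom :: "'v fm \<Rightarrow> bool" where
  Par_Nil: "parity_axiom (Neg (Par []))"
| Par_TT: "parity_axiom (Imp A (Imp (Par As) (Neg (Par (A # As)))))"
| Par_TF: "parity_axiom (Imp A (Imp (Neg (Par As)) (Par (A # As))))"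
| Par_FT: "parity_axiom (Imp (Neg A) (Imp (Par As) (Par (A # As))))"
| Par_FF: "parity_axiom (Imp (Neg A) (Imp (Neg (Par As)) (Neg (Par (A # As)))))"

definition frege_proof :: "'v fm list \<Rightarrow> bool" where
  "frege_proof \<pi> \<longleftrightarrow>
     (\<forall>i < length \<pi>. AC0_axiom (\<pi> ! i) \<or> parity_axiom (\<pi> ! i) \<or>
        (\<exists>j < i. \<exists>k < i. \<pi> ! k = Imp (\<pi> ! j) (\<pi> ! i)))"

definition AC0_2_frege_proof_of :: "nat \<Rightarrow> 'v fm list \<Rightarrow> 'v fm \<Rightarrow> bool" where
  "AC0_2_frege_proof_of d \<pi> A \<longleftrightarrow>
     frege_proof \<pi> \<and> \<pi> \<noteq> [] \<and> last \<pi> = A \<and> (\<forall>B \<in> set \<pi>. depth B \<le> d)"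

definition proof_size :: "'v fm list \<Rightarrow> nat" where
  "proof_size \<pi> = sum_list (map symbols \<pi>)"


section \<open>The st-connectivity tautologies\<close>

text \<open>The node \<open>(i, j)\<close> lies in row \<open>i\<close> (counted from the top) and column \<open>j\<close> (counted from the
  left), both starting from 0.\<close>

type_synonym node = "nat \<times> nat"

datatype edge = Horizontal nat nat | Vertical nat nat

primrec endpoints :: "edge \<Rightarrow> node set" where
  "endpoints (Horizontal i j) = {(i, j), (i, Suc j)}"
| "endpoints (Vertical i j) = {(i, j), (Suc i, j)}"

definition grid_nodes :: "nat \<Rightarrow> node list" where
  "grid_nodes n = List.product [0..<n] [0..<n]"

definition grid_edges :: "nat \<Rightarrow> edge list" where
  "grid_edges n =
     [Horizontal i j. i \<leftarrow> [0..<n], j \<leftarrow> [0..<n - 1]] @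
     [Vertical i j. i \<leftarrow> [0..<n - 1], j \<leftarrow> [0..<n]]"

definition incident :: "nat \<Rightarrow> node \<Rightarrow> edge list" where
  "incident n v = filter (\<lambda>e. v \<in> endpoints e) (grid_edges n)"

datatype colour = Blue | Red

text \<open>The variable \<open>(e, Blue)\<close> is $e_b$ and \<open>(e, Red)\<close> is $e_r$.\<close>

type_synonym var = "edge \<times> colour"

definition colours :: "colour list" where
  "colours = [Blue, Red]"

text \<open>Each of the following is a list of clauses about a node, given by the list \<open>es\<close> of the
  edge slots incident to it. The degree of a node is the number of those slots that
  are coloured, blue or red.\<close>

definition degree_one :: "edge list \<Rightarrow> var fm list" where
  "degree_one es =
     [Disj [Var (e, c). e \<leftarrow> es, c \<leftarrow> colours]] @
     [Disj [Neg (Var (e, c)), Neg (Var (f, d))].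
        e \<leftarrow> es, f \<leftarrow> es, e \<noteq> f, c \<leftarrow> colours, d \<leftarrow> colours]"

text \<open>The degree is not one, and no three distinct slots are coloured.\<close>

definition degree_zero_or_two :: "edge list \<Rightarrow> var fm list" where
  "degree_zero_or_two es =
     [Disj (Neg (Var (e, c)) # [Var (f, d). f \<leftarrow> es, f \<noteq> e, d \<leftarrow> colours]).
        e \<leftarrow> es, c \<leftarrow> colours] @
     [Disj [Neg (Var (e, c)), Neg (Var (f, d)), Neg (Var (g, h))].
        e \<leftarrow> es, f \<leftarrow> es, g \<leftarrow> es, distinct [e, f, g],
        c \<leftarrow> colours, d \<leftarrow> colours, h \<leftarrow> colours]"

definition touches :: "colour \<Rightarrow> edge list \<Rightarrow> var fm list" where
  "touches c es = [Disj [Var (e, c). e \<leftarrow> es]]"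

definition not_both_colours :: "edge list \<Rightarrow> var fm list" where
  "not_both_colours es =
     [Disj [Neg (Var (e, Blue)), Neg (Var (f, Red))]. e \<leftarrow> es, f \<leftarrow> es]"

definition blue_corners :: "nat \<Rightarrow> node list" where
  "blue_corners n = [(0, 0), (n - 1, n - 1)]"

definition red_corners :: "nat \<Rightarrow> node list" where
  "red_corners n = [(0, n - 1), (n - 1, 0)]"

definition corners :: "nat \<Rightarrow> node list" where
  "corners n = blue_corners n @ red_corners n"

definition STCONN_clauses :: "nat \<Rightarrow> var fm list" where
  "STCONN_clauses n =
     concat (map (\<lambda>v. degree_one (incident n v)) (corners n)) @
     concat (map (\<lambda>v. touches Blue (incident n v)) (blue_corners n)) @
     concat (map (\<lambda>v. touches Red (incident n v)) (red_corners n)) @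
     concat (map (\<lambda>v. degree_zero_or_two (incident n v))
       (filter (\<lambda>v. v \<notin> set (corners n)) (grid_nodes n))) @
     concat (map (\<lambda>v. not_both_colours (incident n v)) (grid_nodes n))"

definition STCONN :: "nat \<Rightarrow> var fm" where
  "STCONN n = Neg (Conj (STCONN_clauses n))"

end

theory Submission
  imports Defs
begin

text \<open>
  For a node \<open>v = (i, j)\<close> let $Q_v$ be the parity of the red horizontal edges \<open>Horizontal i' (j - 1)\<close>
  with \<open>i' < i\<close>, which is the number of times that the red edges, shifted by half a unit to the lower
  right, cross the vertical ray going up from \<open>v\<close>. If \<open>e\<close> joins \<open>u\<close> and \<open>v\<close> then $Q_u + Q_v$ is,
  by the degree conditions on the red edges above, a single red edge that shares a node with \<open>e\<close>, so
  it vanishes whenever \<open>e\<close> is blue. Hence, modulo 2, the sum of $Q_v e_b$ over all incident pairs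
  $(v, e)$ vanishes edge by edge. Summed node by node, it equals $Q$ at the lower-right corner, as
  the blue degree is odd only there and at the upper-left corner, where $Q = 0$. But $Q = 1$ at the
  lower-right corner, by the degree conditions on the red edges of the last column.

  Only two parity gates over polynomially many formulas have to be compared, one being a permutation
  of the other. All other steps are instances of finitely many fixed tautologies, so completeness of
  the proof system, without any size bound, gives proofs of these of constant length.
\<close>

section \<open>Completeness and uniform bounds for fixed tautologies\<close>

primrec eval :: "('v \<Rightarrow> bool) \<Rightarrow> 'v fm \<Rightarrow> bool" where
  "eval v (Var x) = v x"
| "eval v (Neg A) = (\<not> eval v A)"
| "eval v (Conj As) = (\<forall>b \<in> set (map (eval v) As). b)"
| "eval v (Disj As) = (\<exists>b \<in> set (map (eval v) As). b)"
| "eval v (Par As) = foldr (\<noteq>) (map (eval v) As) False"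

lemma eval_map_fm: "eval v (map_fm f A) = eval (\<lambda>x. v (f x)) A"
proof (induction A)
  case (Par As)
  then have "map (eval v) (map (map_fm f) As) = map (eval (\<lambda>x. v (f x))) As" by auto
  then show ?case by (simp only: eval.simps fm.map)
qed auto

text \<open>Sizes are ignored here, as this relation only serves completeness. The set
  \<open>\<Gamma>\<close> of hypotheses makes room for a deduction theorem.\<close>

inductive derivable :: "'v fm set \<Rightarrow> 'v fm \<Rightarrow> bool" for \<Gamma> where
  hyp: "A \<in> \<Gamma> \<Longrightarrow> derivable \<Gamma> A"
| ax: "AC0_axiom A \<or> parity_axiom A \<Longrightarrow> derivable \<Gamma> A"
| mp: "derivable \<Gamma> (Imp A B) \<Longrightarrow> derivable \<Gamma> A \<Longrightarrow> derivable \<Gamma> B"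

section \<open>Classical reasoning from the axioms\<close>

lemma axI: "AC0_axiom A \<Longrightarrow> derivable \<Gamma> A"
  by (simp add: ax)

lemma paxI: "parity_axiom A \<Longrightarrow> derivable \<Gamma> A"
  by (simp add: ax)

lemma derivable_mono: "derivable \<Gamma> A \<Longrightarrow> \<Gamma> \<subseteq> \<Delta> \<Longrightarrow> derivable \<Delta> A"
  by (induction rule: derivable.induct) (auto intro: derivable.intros)

lemma derivable_refl: "derivable \<Gamma> (Imp A A)"
  by (meson AC0_axiom.K AC0_axiom.S axI mp)

lemma derivable_weaken: "derivable \<Gamma> B \<Longrightarrow> derivable \<Gamma> (Imp A B)"
  by (meson AC0_axiom.K axI mp)

text \<open>Scheme \<open>K\<close> covers the other hypotheses and the axioms, scheme
  \<open>S\<close> covers modus ponens.\<close>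

lemma deduction: "derivable (insert A \<Gamma>) B \<Longrightarrow> derivable \<Gamma> (Imp A B)"
proof (induction rule: derivable.induct)
  case (hyp B)
  then show ?case
    by (metis derivable.hyp derivable_refl derivable_weaken insertE)
next
  case (ax B)
  then show ?case by (simp add: derivable.ax derivable_weaken)
next
  case (mp B D)
  then show ?case by (meson AC0_axiom.S axI derivable.mp)
qed

lemma explosion: "derivable \<Gamma> (Neg A) \<Longrightarrow> derivable \<Gamma> A \<Longrightarrow> derivable \<Gamma> B"
  by (meson Contrapos axI derivable_weaken mp)

lemma double_neg: "derivable \<Gamma> (Neg (Neg A)) \<Longrightarrow> derivable \<Gamma> A"
proof -
  assume a: "derivable \<Gamma> (Neg (Neg A))"
  \<comment> \<open>The hypothesis \<open>Neg A\<close> contradicts \<open>Neg (Neg A)\<close> and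
    so yields even \<open>Neg (Neg (Neg A))\<close>. Contraposition of this implication is
    \<open>Imp (Neg (Neg A)) A\<close>.\<close>
  then have "derivable (insert (Neg A) \<Gamma>) (Neg (Neg (Neg A)))"
    by (meson derivable_mono explosion hyp insertI1 subset_insertI)
  then show ?thesis
    using a by (meson Contrapos axI deduction mp)
qed

lemma reductio:
  assumes "derivable (insert A \<Gamma>) B" "derivable (insert A \<Gamma>) (Neg B)"
  shows "derivable \<Gamma> (Neg A)"
proof -
  \<comment> \<open>The negation of this theorem plays the role of falsum:
    \<open>Imp (Neg (Neg A)) (Neg ?T)\<close> is contraposed to
    \<open>Imp ?T (Neg A)\<close>.\<close>
  let ?T = "Imp A A"
  have "derivable \<Gamma> (Imp A (Neg ?T))"
    using assms by (meson deduction explosion)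
  then have "derivable (insert (Neg (Neg A)) \<Gamma>) (Neg ?T)"
    by (meson derivable_mono double_neg hyp insertI1 mp subset_insertI)
  then show ?thesis
    by (meson Contrapos axI deduction derivable_refl mp)
qed

lemma by_cases:
  assumes "derivable (insert A \<Gamma>) B" "derivable (insert (Neg A) \<Gamma>) B"
  shows "derivable \<Gamma> B"
proof -
  have "derivable (insert A (insert (Neg B) \<Gamma>)) B"
    using assms(1) by (rule derivable_mono) auto
  then have "derivable (insert (Neg B) \<Gamma>) (Neg A)"
    by (meson hyp insertI1 insertI2 reductio)
  moreover have "derivable (insert (Neg B) \<Gamma>) (Imp (Neg A) B)"
    using assms(2) by (meson deduction derivable_mono subset_insertI)
  ultimately have "derivable (insert (Neg B) \<Gamma>) B"
    by (meson mp)
  then show ?thesis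
    by (meson double_neg hyp insertI1 reductio)
qed

definition lit :: "bool \<Rightarrow> 'v fm \<Rightarrow> 'v fm" where
  "lit b A = (if b then A else Neg A)"

text \<open>Kalmar's lemma, by induction on the formula: the axioms of each gate let the system
  compute its value from the values of its inputs. \<open>Conj\<close> and \<open>Disj\<close> need
  a list induction in one case only, \<open>Par\<close> in both.\<close>

lemma kalmar:
  assumes "\<And>x. x \<in> set_fm A \<Longrightarrow> derivable \<Gamma> (lit (v x) (Var x))"
  shows "derivable \<Gamma> (lit (eval v A) A)"
  using assms
proof (induction A)
  case (Var x)
  then show ?case by simp
next
  case (Neg A)
  have *: "derivable \<Gamma> (lit (eval v A) A)"
    using Neg by simp
  show ?case
  proof (cases "eval v A")
    case True
    then have "derivable \<Gamma> A" using * by (simp add: lit_def)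
    then have "derivable \<Gamma> (Neg (Neg A))"
      by (meson derivable_mono hyp insertI1 reductio subset_insertI)
    then show ?thesis using True by (simp add: lit_def)
  next
    case False
    then show ?thesis using * by (simp add: lit_def)
  qed
next
  case (Conj As)
  then have IH: "derivable \<Gamma> (lit (eval v A) A)" if "A \<in> set As" for A
    using that by auto
  show ?case
  proof (cases "eval v (Conj As)")
    case True
    with IH have "derivable \<Gamma> A" if "A \<in> set As" for A
      using that by (fastforce simp: lit_def)
    then have "derivable \<Gamma> (Conj As)"
    proof (induction As)
      case Nil
      then show ?case by (simp add: Conj_Nil axI)
    next
      case (Cons A As)
      then show ?case by (meson Conj_intro axI list.set_intros mp)
    qed
    with True show ?thesis by (simp add: lit_def)
  next
    case False
    then obtain A where A: "A \<in> set As" "\<not> eval v A" by auto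
    with IH have "derivable (insert (Conj As) \<Gamma>) (Neg A)"
      by (metis derivable_mono lit_def subset_insertI)
    then have "derivable \<Gamma> (Neg (Conj As))"
      using A by (meson Conj_elim axI hyp insertI1 mp reductio)
    with False show ?thesis by (simp only: lit_def if_False)
  qed
next
  case (Disj As)
  then have IH: "derivable \<Gamma> (lit (eval v A) A)" if "A \<in> set As" for A
    using that by auto
  show ?case
  proof (cases "eval v (Disj As)")
    case True
    then obtain A where A: "A \<in> set As" "eval v A" by auto
    with IH have "derivable \<Gamma> A"
      by (metis lit_def)
    then have "derivable \<Gamma> (Disj As)"
      using A by (meson Disj_intro axI mp)
    with True show ?thesis by (simp add: lit_def)
  next
    case False
    with IH have "derivable \<Gamma> (Neg A)" if "A \<in> set As" for A
      using that by (fastforce simp: lit_def)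
    then have "derivable \<Gamma> (Neg (Disj As))"
    proof (induction As)
      case Nil
      then show ?case by (simp add: Disj_Nil axI)
    next
      case (Cons A As)
      then have "derivable (insert (Disj (A # As)) \<Gamma>) (Neg A)"
        "derivable (insert (Disj (A # As)) \<Gamma>) (Neg (Disj As))"
        by (meson derivable_mono list.set_intros subset_insertI)+
      then show ?case by (meson Disj_elim axI hyp insertI1 mp reductio)
    qed
    with False show ?thesis by (simp add: lit_def)
  qed
next
  case (Par As)
  then have "derivable \<Gamma> (lit (eval v A) A)" if "A \<in> set As" for A
    using that by auto
  then show ?case
  proof (induction As)
    case Nil
    then show ?case by (simp add: Par_Nil paxI lit_def)
  next
    case (Cons A As)
    then have "derivable \<Gamma> (lit (eval v A) A)" "derivable \<Gamma> (lit (eval v (Par As)) (Par As))"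
      by simp_all
    then show ?case
      by (cases "eval v A"; cases "eval v (Par As)")
        (simp_all add: lit_def, (meson parity_axiom.intros paxI mp)+)
  qed
qed

text \<open>The valuation is arbitrary, so both literals of a variable \<open>x\<close> may be
  assumed. A case distinction then removes \<open>x\<close> from the hypotheses, one variable at a
  time.\<close>

lemma derivable_lits:
  assumes "finite V" "\<And>v. derivable ((\<lambda>x. lit (v x) (Var x)) ` V) A"
  shows "derivable {} A"
  using assms
proof (induction V)
  case empty
  then show ?case by simp
next
  case (insert x V)
  have "derivable ((\<lambda>x. lit (v x) (Var x)) ` V) A" for v
  proof (rule by_cases)
    have *: "(\<lambda>y. lit ((v(x := b)) y) (Var y)) ` insert x V
        = insert (lit b (Var x)) ((\<lambda>x. lit (v x) (Var x)) ` V)" for b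
      using insert.hyps by (auto simp: image_iff)
    show "derivable (insert (Var x) ((\<lambda>x. lit (v x) (Var x)) ` V)) A"
      using insert.prems[of "v(x := True)"] unfolding * by (simp add: lit_def)
    show "derivable (insert (Neg (Var x)) ((\<lambda>x. lit (v x) (Var x)) ` V)) A"
      using insert.prems[of "v(x := False)"] unfolding * by (simp add: lit_def)
  qed
  then show ?case by (rule insert.IH)
qed

lemma finite_set_fm: "finite (set_fm A)"
  by (induction A) auto

theorem completeness:
  assumes "\<And>v. eval v A"
  shows "derivable {} A"
proof (rule derivable_lits[OF finite_set_fm[of A]])
  fix v
  have "derivable ((\<lambda>x. lit (v x) (Var x)) ` set_fm A) (lit (eval v A) A)"
    by (rule kalmar) (simp add: hyp)
  then show "derivable ((\<lambda>x. lit (v x) (Var x)) ` set_fm A) A"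
    using assms by (simp add: lit_def)
qed

section \<open>Frege proofs as lists of lines\<close>

lemma frege_proof_append:
  assumes "frege_proof \<pi>" "frege_proof \<rho>"
  shows "frege_proof (\<pi> @ \<rho>)"
  unfolding frege_proof_def
proof (intro allI impI)
  fix i assume i: "i < length (\<pi> @ \<rho>)"
  show "AC0_axiom ((\<pi> @ \<rho>) ! i) \<or> parity_axiom ((\<pi> @ \<rho>) ! i) \<or>
    (\<exists>j<i. \<exists>k<i. (\<pi> @ \<rho>) ! k = Imp ((\<pi> @ \<rho>) ! j) ((\<pi> @ \<rho>) ! i))"
  proof (cases "i < length \<pi>")
    case True
    then show ?thesis
      using assms(1) by (simp add: frege_proof_def nth_append) (metis order.strict_trans)
  next
    case False
    then obtain i' where i': "i = length \<pi> + i'" "i' < length \<rho>"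
      using i by (metis add_diff_inverse_nat length_append nat_add_left_cancel_less)
    from assms(2) i'(2) consider "AC0_axiom (\<rho> ! i')" | "parity_axiom (\<rho> ! i')"
      | j k where "j < i'" "k < i'" "\<rho> ! k = Imp (\<rho> ! j) (\<rho> ! i')"
      unfolding frege_proof_def by blast
    then show ?thesis
    proof cases
      case 3
      then show ?thesis
        unfolding i'(1)
        by (intro disjI2 exI[of _ "length \<pi> + j"] conjI exI[of _ "length \<pi> + k"]) simp_all
    qed (simp_all add: i')
  qed
qed

lemma frege_proof_snoc:
  assumes "frege_proof \<pi>" "A \<in> set \<pi>" "Imp A B \<in> set \<pi>"
  shows "frege_proof (\<pi> @ [B])"
  unfolding frege_proof_def
proof (intro allI impI)
  fix i assume i: "i < length (\<pi> @ [B])"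
  show "AC0_axiom ((\<pi> @ [B]) ! i) \<or> parity_axiom ((\<pi> @ [B]) ! i) \<or>
    (\<exists>j<i. \<exists>k<i. (\<pi> @ [B]) ! k = Imp ((\<pi> @ [B]) ! j) ((\<pi> @ [B]) ! i))"
  proof (cases "i < length \<pi>")
    case True
    then show ?thesis
      using assms(1) by (simp add: frege_proof_def nth_append) (metis order.strict_trans)
  next
    case False
    then have "i = length \<pi>" using i by simp
    moreover obtain j k where "j < length \<pi>" "k < length \<pi>" "\<pi> ! j = A" "\<pi> ! k = Imp A B"
      using assms by (metis in_set_conv_nth)
    ultimately show ?thesis
      by (intro disjI2 exI[of _ j] conjI exI[of _ k]) (simp_all add: nth_append)
  qed
qed

lemma frege_proof_axiom: "AC0_axiom A \<or> parity_axiom A \<Longrightarrow> frege_proof [A]"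
  by (auto simp: frege_proof_def)

lemma derivable_imp_proof:
  "derivable {} A \<Longrightarrow> \<exists>\<pi>. frege_proof \<pi> \<and> \<pi> \<noteq> [] \<and> last \<pi> = A"
proof (induction rule: derivable.induct)
  case (ax A)
  then show ?case
    by (intro exI[of _ "[A]"]) (simp add: frege_proof_axiom)
next
  case (mp A B)
  then obtain \<pi> \<rho> where "frege_proof \<pi>" "\<pi> \<noteq> []" "last \<pi> = Imp A B"
    "frege_proof \<rho>" "\<rho> \<noteq> []" "last \<rho> = A" by blast
  then have "frege_proof ((\<pi> @ \<rho>) @ [B])"
    by (intro frege_proof_snoc[of _ A] frege_proof_append) (metis Un_iff last_in_set set_append)+
  then show ?case by force
qed simp

section \<open>Finitely many formulas of bounded size\<close>

lemma symbols_pos: "0 < symbols A"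
  by (cases A) auto

lemma length_le_symbols: "length As \<le> sum_list (map symbols As)"
proof (induction As)
  case (Cons A As)
  then show ?case using symbols_pos[of A] by simp
qed simp

text \<open>Fan-in is unbounded, but every input has at least one symbol. Hence a gate with
  \<open>Suc s\<close> symbols has at most \<open>s\<close> inputs, each of size at most
  \<open>s\<close>, and only finitely many lists of inputs are possible.\<close>

lemma finite_formulas:
  assumes "finite V"
  shows "finite {A :: 'v fm. set_fm A \<subseteq> V \<and> symbols A \<le> s}"
proof (induction s)
  case 0
  have "{A :: 'v fm. set_fm A \<subseteq> V \<and> symbols A \<le> 0} = {}"
    using symbols_pos by (auto simp: not_le)
  then show ?case by (simp only: finite.emptyI)
next
  case (Suc s)
  let ?F = "{A :: 'v fm. set_fm A \<subseteq> V \<and> symbols A \<le> s}"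
  let ?L = "{As. set As \<subseteq> ?F \<and> length As \<le> s}"
  have list: "As \<in> ?L" if "sum_list (map symbols As) \<le> s" "\<forall>A \<in> set As. set_fm A \<subseteq> V"
    for As :: "'v fm list"
  proof -
    have "symbols A \<le> sum_list (map symbols As)" if "A \<in> set As" for A
      using that by (simp add: member_le_sum_list)
    then show ?thesis
      using that length_le_symbols[of As] by fastforce
  qed
  have "{A :: 'v fm. set_fm A \<subseteq> V \<and> symbols A \<le> Suc s}
      \<subseteq> Var ` V \<union> Neg ` ?F \<union> Conj ` ?L \<union> Disj ` ?L \<union> Par ` ?L"
  proof
    fix A :: "'v fm" assume "A \<in> {A. set_fm A \<subseteq> V \<and> symbols A \<le> Suc s}"
    then show "A \<in> Var ` V \<union> Neg ` ?F \<union> Conj ` ?L \<union> Disj ` ?L \<union> Par ` ?L"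
      using list by (cases A) (auto simp: UN_subset_iff)
  qed
  moreover have "finite ?L"
    using Suc.IH by (rule finite_lists_length_le)
  ultimately show ?case
    using assms Suc.IH by (meson finite_UnI finite_imageI finite_subset)
qed

text \<open>Completeness gives each tautology some proof, of unknown size. As only finitely many
  formulas are concerned, one number bounds all the chosen proofs.\<close>

lemma tautologies_uniform:
  "\<exists>N. \<forall>A :: nat fm. set_fm A \<subseteq> {..<m} \<longrightarrow> symbols A \<le> s \<longrightarrow> (\<forall>v. eval v A) \<longrightarrow>
     (\<exists>\<pi>. frege_proof \<pi> \<and> \<pi> \<noteq> [] \<and> last \<pi> = A \<and> length \<pi> \<le> N \<and>
        (\<forall>B \<in> set \<pi>. depth B \<le> N \<and> symbols B \<le> N))"
proof -
  define T where "T = {A :: nat fm. set_fm A \<subseteq> {..<m} \<and> symbols A \<le> s \<and> (\<forall>v. eval v A)}"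
  have fin: "finite T"
    unfolding T_def
    by (rule finite_subset[OF _ finite_formulas[of "{..<m}" s]]) auto
  have "\<exists>\<pi>. frege_proof \<pi> \<and> \<pi> \<noteq> [] \<and> last \<pi> = A" if "A \<in> T" for A
    using that by (intro derivable_imp_proof completeness) (simp add: T_def)
  then obtain f where f: "\<And>A. A \<in> T \<Longrightarrow> frege_proof (f A) \<and> f A \<noteq> [] \<and> last (f A) = A"
    by metis
  \<comment> \<open>A crude measure that dominates the length, all depths and all line sizes of the
    chosen proof. Its sum over \<open>T\<close> is the common bound.\<close>
  define b where "b A = length (f A) + sum_list (map depth (f A)) + proof_size (f A)" for A
  have bound: "length (f A) \<le> sum b T \<and>
      (\<forall>B \<in> set (f A). depth B \<le> sum b T \<and> symbols B \<le> sum b T)" if "A \<in> T" for A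
  proof -
    have "b A \<le> sum b T"
      using fin that by (simp add: member_le_sum)
    moreover have "depth B \<le> b A" "symbols B \<le> b A" if "B \<in> set (f A)" for B
      using that member_le_sum_list[of "depth B" "map depth (f A)"]
        member_le_sum_list[of "symbols B" "map symbols (f A)"]
      by (auto simp: b_def proof_size_def)
    moreover have "length (f A) \<le> b A"
      by (simp add: b_def)
    ultimately show ?thesis
      using le_trans by blast
  qed
  show ?thesis
  proof (intro exI[of _ "sum b T"] allI impI)
    fix A :: "nat fm"
    assume "set_fm A \<subseteq> {..<m}" "symbols A \<le> s" "\<forall>v. eval v A"
    then have "A \<in> T" by (simp add: T_def)
    from f[OF this] bound[OF this]
    show "\<exists>\<pi>. frege_proof \<pi> \<and> \<pi> \<noteq> [] \<and> last \<pi> = A \<and> length \<pi> \<le> sum b T \<and>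
        (\<forall>B \<in> set \<pi>. depth B \<le> sum b T \<and> symbols B \<le> sum b T)"
      by (intro exI[of _ "f A"] conjI) simp_all
  qed
qed

section \<open>Bounded provability\<close>

primrec subst :: "('a \<Rightarrow> 'v fm) \<Rightarrow> 'a fm \<Rightarrow> 'v fm" where
  "subst \<sigma> (Var x) = \<sigma> x"
| "subst \<sigma> (Neg A) = Neg (subst \<sigma> A)"
| "subst \<sigma> (Conj As) = Conj (map (subst \<sigma>) As)"
| "subst \<sigma> (Disj As) = Disj (map (subst \<sigma>) As)"
| "subst \<sigma> (Par As) = Par (map (subst \<sigma>) As)"

lemma AC0_axiom_subst: "AC0_axiom A \<Longrightarrow> AC0_axiom (subst \<sigma> A)"
  by (induction rule: AC0_axiom.induct) (auto intro: AC0_axiom.intros)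

lemma parity_axiom_subst: "parity_axiom A \<Longrightarrow> parity_axiom (subst \<sigma> A)"
  by (induction rule: parity_axiom.induct) (auto intro: parity_axiom.intros)

lemma frege_proof_subst:
  assumes "frege_proof \<pi>"
  shows "frege_proof (map (subst \<sigma>) \<pi>)"
  unfolding frege_proof_def
proof (intro allI impI)
  fix i assume i: "i < length (map (subst \<sigma>) \<pi>)"
  then consider "AC0_axiom (\<pi> ! i)" | "parity_axiom (\<pi> ! i)"
    | j k where "j < i" "k < i" "\<pi> ! k = Imp (\<pi> ! j) (\<pi> ! i)"
    using assms unfolding frege_proof_def by auto
  then show "AC0_axiom (map (subst \<sigma>) \<pi> ! i) \<or> parity_axiom (map (subst \<sigma>) \<pi> ! i) \<or>
    (\<exists>j<i. \<exists>k<i. map (subst \<sigma>) \<pi> ! k = Imp (map (subst \<sigma>) \<pi> ! j) (map (subst \<sigma>) \<pi> ! i))"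
  proof cases
    case 3
    then show ?thesis
      using i by (intro disjI2 exI[of _ j] conjI exI[of _ k]) simp_all
  qed (use i in \<open>simp_all add: AC0_axiom_subst parity_axiom_subst\<close>)
qed

lemma fold_max_le_iff: "fold max xs a \<le> (b::nat) \<longleftrightarrow> a \<le> b \<and> (\<forall>x \<in> set xs. x \<le> b)"
  by (induction xs arbitrary: a) auto

lemma depth_subst_le: "(\<And>x. depth (\<sigma> x) \<le> d) \<Longrightarrow> depth (subst \<sigma> A) \<le> depth A + d"
proof (induction A)
  case (Conj As)
  have "depth A \<le> fold max (map depth As) 0" if "A \<in> set As" for A
    using that fold_max_le_iff[of "map depth As" 0 "fold max (map depth As) 0"] by simp
  with Conj show ?case
    by (fastforce simp: fold_max_le_iff intro: order_trans[OF _ add_right_mono])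
next
  case (Disj As)
  have "depth A \<le> fold max (map depth As) 0" if "A \<in> set As" for A
    using that fold_max_le_iff[of "map depth As" 0 "fold max (map depth As) 0"] by simp
  with Disj show ?case
    by (fastforce simp: fold_max_le_iff intro: order_trans[OF _ add_right_mono])
next
  case (Par As)
  have "depth A \<le> fold max (map depth As) 0" if "A \<in> set As" for A
    using that fold_max_le_iff[of "map depth As" 0 "fold max (map depth As) 0"] by simp
  with Par show ?case
    by (fastforce simp: fold_max_le_iff intro: order_trans[OF _ add_right_mono])
qed auto

lemma symbols_subst_le:
  assumes "\<And>x. symbols (\<sigma> x) \<le> M" "1 \<le> M"
  shows "symbols (subst \<sigma> A) \<le> symbols A * M"
proof (induction A)
  case (Conj As)
  then have "sum_list (map (symbols \<circ> subst \<sigma>) As) \<le> sum_list (map (\<lambda>A. symbols A * M) As)"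
    by (intro sum_list_mono) simp
  with assms(2) show ?case by (simp add: sum_list_mult_const flip: sum_list_mult_const)
next
  case (Disj As)
  then have "sum_list (map (symbols \<circ> subst \<sigma>) As) \<le> sum_list (map (\<lambda>A. symbols A * M) As)"
    by (intro sum_list_mono) simp
  with assms(2) show ?case by (simp add: sum_list_mult_const flip: sum_list_mult_const)
next
  case (Par As)
  then have "sum_list (map (symbols \<circ> subst \<sigma>) As) \<le> sum_list (map (\<lambda>A. symbols A * M) As)"
    by (intro sum_list_mono) simp
  with assms(2) show ?case by (simp add: sum_list_mult_const flip: sum_list_mult_const)
qed (use assms in auto)

lemma subst_map_fm: "(\<And>x. x \<in> set_fm A \<Longrightarrow> \<sigma> (f x) = Var x) \<Longrightarrow> subst \<sigma> (map_fm f A) = A"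
  by (induction A) (auto intro!: map_idI, metis+)

lemma symbols_map_fm: "symbols (map_fm f A) = symbols A"
  by (induction A) (auto intro!: arg_cong[of _ _ sum_list])

text \<open>The three bounds are kept apart because only the number \<open>k\<close> of lines grows
  when proofs are combined. The depth \<open>d\<close> and the line size \<open>m\<close> stay fixed
  throughout.\<close>

definition prv :: "nat \<Rightarrow> nat \<Rightarrow> nat \<Rightarrow> 'v fm \<Rightarrow> bool" where
  "prv d m k A \<longleftrightarrow> (\<exists>\<pi>. frege_proof \<pi> \<and> \<pi> \<noteq> [] \<and> last \<pi> = A \<and> length \<pi> \<le> k \<and>
     (\<forall>B \<in> set \<pi>. depth B \<le> d \<and> symbols B \<le> m))"

lemma prv_mono: "prv d m k A \<Longrightarrow> k \<le> l \<Longrightarrow> prv d m l A"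
  unfolding prv_def by (metis le_trans)

lemma prv_axiom:
  "AC0_axiom A \<or> parity_axiom A \<Longrightarrow> depth A \<le> d \<Longrightarrow> symbols A \<le> m \<Longrightarrow> prv d m 1 A"
  unfolding prv_def by (intro exI[of _ "[A]"]) (simp add: frege_proof_axiom)

lemma prv_mp:
  assumes "prv d m k (Imp A B)" "prv d m l A"
  shows "prv d m (k + l + 1) B"
proof -
  from assms obtain \<pi> \<rho> where
    \<pi>: "frege_proof \<pi>" "\<pi> \<noteq> []" "last \<pi> = Imp A B" "length \<pi> \<le> k"
      "\<forall>B \<in> set \<pi>. depth B \<le> d \<and> symbols B \<le> m" and
    \<rho>: "frege_proof \<rho>" "\<rho> \<noteq> []" "last \<rho> = A" "length \<rho> \<le> l"
      "\<forall>B \<in> set \<rho>. depth B \<le> d \<and> symbols B \<le> m"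
    unfolding prv_def by metis
  have "Imp A B \<in> set \<pi>" "A \<in> set \<rho>"
    using \<pi>(2,3) \<rho>(2,3) last_in_set by metis+
  then have "frege_proof ((\<pi> @ \<rho>) @ [B])"
    using \<pi>(1) \<rho>(1) by (intro frege_proof_snoc[of _ A] frege_proof_append) simp_all
  \<comment> \<open>The new line \<open>B\<close> is a subformula of an old one, so it respects the
    same bounds.\<close>
  moreover have "depth (Imp A B) \<le> d \<and> symbols (Imp A B) \<le> m"
    using \<pi>(5) \<open>Imp A B \<in> set \<pi>\<close> by blast
  then have "depth B \<le> d \<and> symbols B \<le> m"
    by auto
  ultimately show ?thesis
    unfolding prv_def using \<pi> \<rho> by (intro exI[of _ "\<pi> @ \<rho> @ [B]"]) auto
qed

text \<open>The argument is carried out under the hypothesis \<open>C\<close>. The formulas that are substituted for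
  the letters of a fixed tautology have depth at most \<open>d\<close> and size at most \<open>M\<close>; the number \<open>N\<close>
  bounds the proofs of all the fixed tautologies.\<close>

locale bounded_frege =
  fixes N d M :: nat and C :: "'v fm"
  assumes uniform: "\<And>A :: nat fm. set_fm A \<subseteq> {..<20} \<Longrightarrow> symbols A \<le> 50000 \<Longrightarrow> (\<And>v. eval v A) \<Longrightarrow>
      \<exists>\<pi>. frege_proof \<pi> \<and> \<pi> \<noteq> [] \<and> last \<pi> = A \<and> length \<pi> \<le> N \<and>
        (\<forall>B \<in> set \<pi>. depth B \<le> N \<and> symbols B \<le> N)"
    and N_ge: "40 \<le> N" and d_ge: "1 \<le> d" and M_ge: "1 \<le> M"
    and depth_C: "depth C \<le> d" and symbols_C: "symbols C \<le> M"
begin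

definition small :: "'v fm \<Rightarrow> bool" where
  "small A \<longleftrightarrow> depth A \<le> d \<and> symbols A \<le> M"

text \<open>The hypothesis is carried along as an antecedent, which avoids the blow-up of repeated
  uses of the deduction theorem.\<close>

definition proves :: "nat \<Rightarrow> 'v fm \<Rightarrow> bool" where
  "proves k A \<longleftrightarrow> prv (N + d) (N * M) k (Imp C A)"

text \<open>A constant cost that absorbs one use of a fixed tautology (\<open>N\<close> lines) with
  up to 49000 one-line premises and as many applications of modus ponens.\<close>

definition K where "K = N + 100000"

text \<open>The default value matters: for lists of fewer than 20 formulas, letter 19 always stands
  for the hypothesis \<open>C\<close>.\<close>

definition inst :: "'v fm list \<Rightarrow> nat \<Rightarrow> 'v fm" where
  "inst As x = (if x < length As then As ! x else C)"

section \<open>Fixed tautologies as rules of inference\<close>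

lemma proves_mono: "proves k A \<Longrightarrow> k \<le> l \<Longrightarrow> proves l A"
  unfolding proves_def by (rule prv_mono)

text \<open>Substitution leaves the number of lines unchanged, adds at most \<open>d\<close> to
  their depth and multiplies their size by at most \<open>M\<close>.\<close>

lemma tautology_instance:
  fixes A :: "nat fm"
  assumes "set_fm A \<subseteq> {..<20}" "symbols A \<le> 50000" "\<And>v. eval v A" "\<And>x. small (\<sigma> x)"
  shows "prv (N + d) (N * M) N (subst \<sigma> A)"
proof -
  from uniform[OF assms(1-3)] obtain \<pi> where
    \<pi>: "frege_proof \<pi>" "\<pi> \<noteq> []" "last \<pi> = A" "length \<pi> \<le> N"
      "\<forall>B \<in> set \<pi>. depth B \<le> N \<and> symbols B \<le> N" by blast
  have "depth (subst \<sigma> B) \<le> N + d \<and> symbols (subst \<sigma> B) \<le> N * M" if "B \<in> set \<pi>" for B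
  proof
    show "depth (subst \<sigma> B) \<le> N + d"
      using depth_subst_le[of \<sigma> d B] assms(4) \<pi>(5) that
      by (fastforce simp: small_def intro: order_trans[OF _ add_right_mono])
    show "symbols (subst \<sigma> B) \<le> N * M"
      using symbols_subst_le[of \<sigma> M B] assms(4) \<pi>(5) that M_ge
      by (fastforce simp: small_def intro: order_trans[OF _ mult_right_mono])
  qed
  then show ?thesis
    unfolding prv_def using \<pi>
    by (intro exI[of _ "map (subst \<sigma>) \<pi>"]) (auto simp: frege_proof_subst last_map)
qed

lemma prv_foldr_Imp:
  assumes "list_all2 (\<lambda>k A. prv d' m k (subst \<sigma> (f A))) ks As"
    "prv d' m k0 (subst \<sigma> (foldr (\<lambda>A. Imp (f A)) As B))"
  shows "prv d' m (k0 + sum_list ks + length As) (subst \<sigma> B)"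
  using assms
proof (induction arbitrary: k0 rule: list_all2_induct)
  case Nil
  then show ?case by simp
next
  case (Cons k ks A As)
  have "prv d' m (k0 + k + 1) (subst \<sigma> (foldr (\<lambda>A. Imp (f A)) As B))"
    using prv_mp[OF _ Cons.hyps(1)] Cons.prems by simp
  from Cons.IH[OF this] show ?case
    by (simp add: algebra_simps)
qed

text \<open>The two implications around a premise cost five symbols. The factor 7 absorbs them,
  since the premise itself has at least one.\<close>

lemma symbols_foldr_Imp:
  "symbols (foldr (\<lambda>A. Imp (Imp (Var x) A)) As B) \<le> 7 * sum_list (map symbols As) + symbols B"
proof (induction As)
  case (Cons A As)
  then show ?case using symbols_pos[of A] by simp
qed simp

text \<open>The workhorse of the later arguments: any inference that is valid for the letters
  becomes a rule for the small formulas \<open>Xs\<close> substituted for them. The premises are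
  made antecedents of one tautology, with letter 19 as a guard that is instantiated by
  \<open>C\<close>, and are then detached by modus ponens. The cost beyond the premises is one line
  per premise and \<open>N\<close> more.\<close>

lemma tautological_step:
  assumes prems: "list_all2 proves ks (map (subst (inst Xs)) As)"
    and atoms: "length Xs < 20" "\<And>X. X \<in> set Xs \<Longrightarrow> small X"
    and vars: "\<And>A. A \<in> set (B # As) \<Longrightarrow> set_fm A \<subseteq> {..<length Xs}"
    and concl: "D = subst (inst Xs) B" and bound: "sum_list ks + length As + N \<le> k"
    and size: "7 * sum_list (map symbols As) + symbols B \<le> 49000"
    and valid: "\<And>v. (\<forall>A \<in> set As. eval v A) \<Longrightarrow> eval v B"
  shows "proves k D"
proof -
  let ?F = "foldr (\<lambda>A. Imp (Imp (Var 19) A)) As (Imp (Var 19) B)"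
  have "prv (N + d) (N * M) N (subst (inst Xs) ?F)"
  proof (rule tautology_instance)
    have "set_fm ?F \<subseteq> {..<20} \<union> \<Union> (set_fm ` set (B # As))"
      by (induction As) auto
    with vars atoms(1) show "set_fm ?F \<subseteq> {..<20}"
      by fastforce
    show "symbols ?F \<le> 50000"
      using size symbols_foldr_Imp[of 19 As "Imp (Var 19) B"] by simp
    show "eval v ?F" for v
    proof -
      have "eval v ?F \<longleftrightarrow> ((\<forall>A \<in> set As. v 19 \<longrightarrow> eval v A) \<longrightarrow> v 19 \<longrightarrow> eval v B)"
        by (induction As) auto
      with valid show ?thesis by blast
    qed
    show "small (inst Xs x)" for x
      using atoms(2) depth_C symbols_C by (simp add: inst_def small_def)
  qed
  from prv_foldr_Imp[OF _ this] prems
  have "prv (N + d) (N * M) (N + sum_list ks + length As) (subst (inst Xs) (Imp (Var 19) B))"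
    using atoms(1) by (simp add: proves_def inst_def list_all2_map2)
  then show ?thesis
    using atoms(1) bound by (auto simp: proves_def inst_def concl add_ac elim!: prv_mono)
qed

text \<open>The variant for premises that are given as formulas in few actual variables, not as
  instances. The variables are numbered, and substituting them back for their numbers restores the
  formulas.\<close>

lemma tautological_step_local:
  assumes prems: "\<And>A. A \<in> set As \<Longrightarrow> proves 1 A"
    and V: "finite V" "card V < 20" "\<And>A. A \<in> set (B # As) \<Longrightarrow> set_fm A \<subseteq> V"
    and d: "\<And>x. small (Var x)"
    and size: "7 * sum_list (map symbols As) + symbols B \<le> 49000"
    and valid: "\<And>v. (\<forall>A \<in> set As. eval v A) \<Longrightarrow> eval v B"
  shows "proves K B"
proof -
  obtain xs where xs: "set xs = V" "distinct xs"
    using finite_distinct_list[OF V(1)] by blast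
  then have len: "length xs < 20"
    using V(2) distinct_card by fastforce
  \<comment> \<open>The position of a variable in \<open>xs\<close>, which serves as its
    letter.\<close>
  define f where "f x = (SOME i. i < length xs \<and> xs ! i = x)" for x
  have f: "f x < length xs \<and> xs ! f x = x" if "x \<in> V" for x
    unfolding f_def using that xs(1) by (intro someI_ex[of "\<lambda>i. i < length xs \<and> xs ! i = x"])
      (auto simp: in_set_conv_nth)
  have inst: "subst (inst (map Var xs)) (map_fm f A) = A" if "A \<in> set (B # As)" for A
    using V(3)[OF that] f by (intro subst_map_fm) (auto simp: inst_def)
  have "length As \<le> 49000"
    using size length_le_symbols[of As] by simp
  show ?thesis
  proof (rule tautological_step)
    show "list_all2 proves (map (\<lambda>_. 1) As) (map (subst (inst (map Var xs))) (map (map_fm f) As))"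
      using prems inst by (simp add: list_all2_conv_all_nth)
    show "set_fm A \<subseteq> {..<length (map Var xs)}" if "A \<in> set (map_fm f B # map (map_fm f) As)" for A
    proof -
      obtain A' where "A' \<in> set (B # As)" "A = map_fm f A'"
        using \<open>A \<in> _\<close> by auto
      then show ?thesis using V(3)[of A'] f by (auto simp: fm.set_map)
    qed
    show "7 * sum_list (map symbols (map (map_fm f) As)) + symbols (map_fm f B) \<le> 49000"
      using size by (simp add: symbols_map_fm comp_def)
    show "eval v (map_fm f B)" if "\<forall>A \<in> set (map (map_fm f) As). eval v A" for v
      using that valid by (simp add: eval_map_fm)
    show "B = subst (inst (map Var xs)) (map_fm f B)"
      using inst by simp
    show "sum_list (map (\<lambda>_. 1) As) + length (map (map_fm f) As) + N \<le> K"
      using \<open>length As \<le> 49000\<close> by (simp add: K_def sum_list_triv)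
  qed (use len d in auto)
qed

text \<open>Three lines suffice: the axiom, an instance of \<open>K\<close> that puts
  \<open>C\<close> in front, and modus ponens. The bounds leave room for the parity axioms over
  small formulas; depth \<open>d + 4\<close> occurs when both premises are negated.\<close>

lemma proves_axiom:
  assumes "AC0_axiom A \<or> parity_axiom A" "depth A \<le> d + 4" "symbols A \<le> 4 * M + 8"
  shows "proves 3 A"
proof -
  have "depth (Imp A (Imp C A)) \<le> N + d" "symbols (Imp A (Imp C A)) \<le> N * M"
  proof -
    show "depth (Imp A (Imp C A)) \<le> N + d"
      using assms(2) depth_C N_ge by simp
    have "symbols (Imp A (Imp C A)) \<le> 40 * M"
      using assms(3) symbols_C M_ge by simp
    also have "\<dots> \<le> N * M" using N_ge by simp
    finally show "symbols (Imp A (Imp C A)) \<le> N * M" .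
  qed
  moreover from this have "depth A \<le> N + d" "symbols A \<le> N * M"
    by auto
  ultimately have "prv (N + d) (N * M) (1 + 1 + 1) (Imp C A)"
    using assms(1) by (intro prv_mp[of _ _ _ A] prv_axiom) (auto intro: AC0_axiom.K)
  then show ?thesis by (simp add: proves_def numeral_3_eq_3)
qed

section \<open>Parity gates as sums over GF(2)\<close>

lemma depth_Par_iff: "depth (Par As) \<le> e \<longleftrightarrow> 1 \<le> e \<and> (\<forall>A \<in> set As. depth A < e)"
  by (cases e) (auto simp: fold_max_le_iff less_Suc_eq_le)

lemma small_Par_Cons:
  assumes "small (Par (A # As))"
  shows "small A" "small (Par As)"
  using assms by (auto simp: small_def depth_Par_iff simp del: depth.simps)

lemma small_Par_append:
  assumes "small (Par (As @ Bs))"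
  shows "small (Par As)" "small (Par Bs)"
  using assms by (auto simp: small_def depth_Par_iff simp del: depth.simps)

lemma small_Par_mset:
  assumes "mset As = mset Bs"
  shows "small (Par As) \<longleftrightarrow> small (Par Bs)"
proof -
  have "set As = set Bs"
    using assms by (rule mset_eq_setD)
  moreover have "sum_list (map symbols As) = sum_list (map symbols Bs)"
    using assms by (metis mset_map sum_mset_sum_list)
  ultimately show ?thesis
    by (simp add: small_def depth_Par_iff del: depth.simps)
qed

text \<open>The equation $A + B + D = 0$ over GF(2) is written as \<open>Neg (Par [A, B, D])\<close>.\<close>

lemma par_Cons:
  assumes "small (Par (A # As))"
  shows "proves K (Neg (Par [Par (A # As), A, Par As]))"
proof -
  note small = assms small_Par_Cons[OF assms]
  have "proves 3 (Imp A (Imp (Par As) (Neg (Par (A # As)))))"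
    "proves 3 (Imp A (Imp (Neg (Par As)) (Par (A # As))))"
    "proves 3 (Imp (Neg A) (Imp (Par As) (Par (A # As))))"
    "proves 3 (Imp (Neg A) (Imp (Neg (Par As)) (Neg (Par (A # As)))))"
    using small by (auto intro!: proves_axiom disjI2 parity_axiom.intros simp: small_def)
  then show ?thesis
    by (intro tautological_step[where ks = "[3, 3, 3, 3]" and Xs = "[A, Par As, Par (A # As)]"
          and As = "[Imp (Var 0) (Imp (Var 1) (Neg (Var 2))),
            Imp (Var 0) (Imp (Neg (Var 1)) (Var 2)),
            Imp (Neg (Var 0)) (Imp (Var 1) (Var 2)),
            Imp (Neg (Var 0)) (Imp (Neg (Var 1)) (Neg (Var 2)))]"
          and B = "Neg (Par [Var 2, Var 0, Var 1])"])
      (use small in \<open>auto simp: inst_def K_def\<close>)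
qed

text \<open>Peeling off the head of the first list takes two uses of \<open>par_Cons\<close> and one
  fixed tautology, so the cost is linear in the length of that list.\<close>

lemma par_append:
  assumes "small (Par (As @ Bs))"
  shows "proves (3 * K * (length As + 1)) (Neg (Par [Par (As @ Bs), Par As, Par Bs]))"
  using assms
proof (induction As)
  case Nil
  then show ?case
    by (intro tautological_step[where ks = "[]" and Xs = "[Par Bs]" and As = "[]"
          and B = "Neg (Par [Var 0, Par [], Var 0])"])
      (auto simp: inst_def K_def)
next
  case (Cons A As)
  then have sm: "small (Par (A # As @ Bs))" by simp
  note small = this small_Par_Cons[OF this] small_Par_append[OF small_Par_Cons(2)[OF this]]
    small_Par_append[of "A # As" Bs, OF Cons.prems]
  have "proves K (Neg (Par [Par (A # As @ Bs), A, Par (As @ Bs)]))"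
    "proves K (Neg (Par [Par (A # As), A, Par As]))"
    "proves (3 * K * (length As + 1)) (Neg (Par [Par (As @ Bs), Par As, Par Bs]))"
    using small par_Cons Cons.IH by auto
  then show ?case
    by (intro tautological_step[where ks = "[K, K, 3 * K * (length As + 1)]"
          and Xs = "[A, Par As, Par Bs, Par (A # As), Par (As @ Bs), Par (A # As @ Bs)]"
          and As = "[Neg (Par [Var 5, Var 0, Var 4]), Neg (Par [Var 3, Var 0, Var 1]),
            Neg (Par [Var 4, Var 1, Var 2])]"
          and B = "Neg (Par [Var 5, Var 3, Var 2])"])
      (use small in \<open>auto simp: inst_def K_def\<close>)
qed

text \<open>The head of the first list is located in the second as \<open>Us @ A # Vs\<close> and
  moved to the front there. This costs linearly many lines by \<open>par_append\<close>, so the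
  whole permutation costs quadratically many.\<close>

lemma par_permute:
  assumes "mset As = mset Bs" "small (Par As)"
  shows "proves (9 * K * (length As + 1)^2) (Neg (Par [Par As, Par Bs]))"
  using assms
proof (induction As arbitrary: Bs)
  case Nil
  then show ?case
    by (intro tautological_step[where ks = "[]" and Xs = "[]" and As = "[]" and B = "Neg (Par [Par [], Par []])"])
      (auto simp: inst_def K_def)
next
  case (Cons A As)
  then have "A \<in> set Bs"
    by (metis list.set_intros(1) set_mset_mset)
  then obtain Us Vs where Bs: "Bs = Us @ A # Vs"
    by (meson split_list)
  with Cons.prems have mset: "mset As = mset (Us @ Vs)"
    by simp
  then have len: "length Us \<le> length As"
    by (metis le_add1 length_append mset_eq_length)
  have "small (Par Bs)" "small (Par (Us @ Vs))"
    using Cons.prems mset small_Par_mset small_Par_Cons by blast+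
  note small = Cons.prems(2) small_Par_Cons[OF Cons.prems(2)] this
    small_Par_append[OF this(1)[unfolded Bs]] small_Par_append[OF this(2)]
  let ?k = "3 * K * (length As + 1)"
  have "3 * K * (length Us + 1) \<le> ?k"
    using len by simp
  then have app: "proves ?k (Neg (Par [Par (Us @ Ws), Par Us, Par Ws]))"
    if "small (Par (Us @ Ws))" for Ws
    using proves_mono par_append[OF that] by blast
  have "proves K (Neg (Par [Par (A # As), A, Par As]))"
    "proves (9 * K * (length As + 1)^2) (Neg (Par [Par As, Par (Us @ Vs)]))"
    "proves ?k (Neg (Par [Par Bs, Par Us, Par (A # Vs)]))"
    "proves ?k (Neg (Par [Par (Us @ Vs), Par Us, Par Vs]))"
    "proves K (Neg (Par [Par (A # Vs), A, Par Vs]))"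
    unfolding Bs by (rule par_Cons Cons.IH[OF mset] app, use small Bs in simp)+
  then show ?case
    by (intro tautological_step[where ks = "[K, 9 * K * (length As + 1)^2, ?k, ?k, K]"
          and Xs = "[A, Par As, Par Bs, Par (A # As), Par (Us @ Vs), Par Us, Par Vs, Par (A # Vs)]"
          and As = "[Neg (Par [Var 3, Var 0, Var 1]), Neg (Par [Var 1, Var 4]),
            Neg (Par [Var 2, Var 5, Var 7]), Neg (Par [Var 4, Var 5, Var 6]),
            Neg (Par [Var 7, Var 0, Var 6])]"
          and B = "Neg (Par [Var 3, Var 2])"])
      (use small in \<open>auto simp: inst_def K_def algebra_simps power2_eq_square\<close>)
qed

text \<open>Blocks of even sum are split off one at a time. The cost of a split depends on the
  length \<open>l\<close> of the block and not on the length of the rest.\<close>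

lemma par_concat:
  assumes "\<And>x. x \<in> set xs \<Longrightarrow> proves k (Neg (Par (f x)))"
    and "\<And>x. x \<in> set xs \<Longrightarrow> length (f x) \<le> l"
    and "small (Par (concat (map f xs)))"
  shows "proves (length xs * (k + 3 * K * (l + 2)) + K) (Neg (Par (concat (map f xs))))"
  using assms
proof (induction xs)
  case Nil
  then show ?case
    by (intro tautological_step[where ks = "[]" and Xs = "[]" and As = "[]" and B = "Neg (Par [])"])
      (auto simp: inst_def K_def)
next
  case (Cons x xs)
  let ?P = "concat (map f xs)"
  let ?k = "length xs * (k + 3 * K * (l + 2)) + K"
  have "small (Par (f x @ ?P))"
    using Cons.prems by simp
  note small = this small_Par_append[OF this]
  have "3 * K * (length (f x) + 1) \<le> 3 * K * (l + 1)"
    using Cons.prems(2) by simp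
  then have "proves (3 * K * (l + 1)) (Neg (Par [Par (f x @ ?P), Par (f x), Par ?P]))"
    using par_append[OF small(1)] proves_mono by blast
  moreover have "proves k (Neg (Par (f x)))" "proves ?k (Neg (Par ?P))"
    using Cons small by auto
  ultimately show ?case
    by (intro tautological_step[where ks = "[3 * K * (l + 1), k, ?k]"
          and Xs = "[Par (f x @ ?P), Par (f x), Par ?P]"
          and As = "[Neg (Par [Var 0, Var 1, Var 2]), Neg (Var 1), Neg (Var 2)]"
          and B = "Neg (Var 0)"])
      (use small in \<open>auto simp: inst_def K_def algebra_simps\<close>)
qed

end

section \<open>The grid\<close>

lemma set_grid_nodes: "set (grid_nodes n) = {..<n} \<times> {..<n}"
  by (auto simp: grid_nodes_def)

lemma distinct_grid_nodes: "distinct (grid_nodes n)"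
  by (simp add: grid_nodes_def distinct_product)

lemma length_grid_nodes: "length (grid_nodes n) = n^2"
  by (simp add: grid_nodes_def power2_eq_square)

lemma set_grid_edges: "set (grid_edges n) =
    {Horizontal i j | i j. i < n \<and> j < n - 1} \<union> {Vertical i j | i j. i < n - 1 \<and> j < n}"
  by (auto simp: grid_edges_def)

lemma concat_map_map: "concat (map (\<lambda>i. map (f i) ys) xs) = map (\<lambda>(i, j). f i j) (List.product xs ys)"
  by (induction xs) (auto simp: comp_def)

lemma distinct_grid_edges: "distinct (grid_edges n)"
proof -
  have "distinct (concat (map (\<lambda>i. map (Horizontal i) [0..<n - 1]) [0..<n]))"
    "distinct (concat (map (\<lambda>i. map (Vertical i) [0..<n]) [0..<n - 1]))"
    by (auto simp: concat_map_map distinct_map distinct_product inj_on_def)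
  then show ?thesis
    by (auto simp: grid_edges_def)
qed

lemma length_grid_edges: "length (grid_edges n) \<le> 2 * n^2"
proof -
  have "length (grid_edges n) = 2 * (n * (n - 1))"
    by (simp add: grid_edges_def length_concat comp_def sum_list_triv)
  also have "\<dots> \<le> 2 * n^2"
    by (simp add: power2_eq_square)
  finally show ?thesis .
qed

lemma mem_incident: "e \<in> set (incident n v) \<longleftrightarrow> e \<in> set (grid_edges n) \<and> v \<in> endpoints e"
  by (auto simp: incident_def)

lemma distinct_incident: "distinct (incident n v)"
  by (simp add: incident_def distinct_grid_edges)

text \<open>The slots in the order up, down, left, right. It is compared with
  \<open>incident\<close> as a set only, which is enough for statements about degrees.\<close>

definition incident_explicit :: "nat \<Rightarrow> nat \<Rightarrow> nat \<Rightarrow> edge list" where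
  "incident_explicit n i j =
     (if 0 < i then [Vertical (i - 1) j] else []) @ (if i < n - 1 then [Vertical i j] else []) @
     (if 0 < j then [Horizontal i (j - 1)] else []) @ (if j < n - 1 then [Horizontal i j] else [])"

lemma distinct_incident_explicit: "distinct (incident_explicit n i j)"
  by (auto simp: incident_explicit_def)

lemma set_incident:
  assumes "i < n" "j < n"
  shows "set (incident n (i, j)) = set (incident_explicit n i j)"
proof (rule set_eqI)
  fix e show "e \<in> set (incident n (i, j)) \<longleftrightarrow> e \<in> set (incident_explicit n i j)"
    using assms by (cases e) (auto simp: mem_incident set_grid_edges incident_explicit_def)
qed

lemma length_incident:
  assumes "v \<in> set (grid_nodes n)"
  shows "length (incident n v) \<le> 4"
proof -
  obtain i j where v: "v = (i, j)" "i < n" "j < n"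
    using assms by (auto simp: set_grid_nodes)
  have "length (incident n v) = card (set (incident_explicit n i j))"
    using v set_incident distinct_card[OF distinct_incident[of n v]] by simp
  also have "\<dots> \<le> length (incident_explicit n i j)"
    by (rule card_length)
  also have "\<dots> \<le> 4"
    by (simp add: incident_explicit_def)
  finally show ?thesis .
qed

subsection \<open>Sizes of the clauses\<close>

abbreviation total :: "'v fm list \<Rightarrow> nat" where
  "total As \<equiv> sum_list (map symbols As)"

lemma total_concat_le:
  assumes "\<And>x. x \<in> set xs \<Longrightarrow> total (f x) \<le> b"
  shows "total (concat (map f xs)) \<le> length xs * b"
  using assms
proof (induction xs)
  case (Cons x xs)
  then show ?case by (fastforce intro: add_mono)
qed simp

lemma total_concat_le':
  "length xs \<le> l \<Longrightarrow> (\<And>x. x \<in> set xs \<Longrightarrow> total (f x) \<le> b) \<Longrightarrow> total (concat (map f xs)) \<le> l * b"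
  using total_concat_le by (meson le_trans mult_le_mono1)

lemma total_degree_one:
  assumes "length es \<le> 4"
  shows "total (degree_one es) \<le> 1000"
proof -
  have "total (concat (map (\<lambda>e. map (\<lambda>c. Var (e, c)) colours) es)) \<le> 4 * 2"
    by (rule total_concat_le'[OF assms]) (simp add: colours_def)
  moreover have "total (concat (map (\<lambda>e. concat (map (\<lambda>f. if e \<noteq> f then
      concat (map (\<lambda>c. map (\<lambda>d. Disj [Neg (Var (e, c)), Neg (Var (f, d))]) colours) colours)
      else []) es)) es)) \<le> 4 * (4 * 30)"
    by (intro total_concat_le'[OF assms]) (simp add: colours_def)
  ultimately show ?thesis
    by (simp add: degree_one_def)
qed

lemma total_touches:
  assumes "length es \<le> 4"
  shows "total (touches c es) \<le> 5"
  using assms by (simp add: touches_def comp_def sum_list_triv)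

lemma total_not_both_colours:
  assumes "length es \<le> 4"
  shows "total (not_both_colours es) \<le> 80"
proof -
  have "total (concat (map (\<lambda>e. map (\<lambda>f. Disj [Neg (Var (e, Blue)), Neg (Var (f, Red))]) es) es))
      \<le> 4 * 20"
    using assms by (intro total_concat_le') (simp_all add: comp_def sum_list_triv)
  then show ?thesis
    by (simp add: not_both_colours_def)
qed

lemma total_degree_zero_or_two:
  assumes "length es \<le> 4"
  shows "total (degree_zero_or_two es) \<le> 4400"
proof -
  have *: "total (concat (map (\<lambda>f. if f \<noteq> e then map (\<lambda>d. Var (f, d)) colours else []) es)) \<le> 4 * 2"
    for e by (rule total_concat_le'[OF assms]) (simp add: colours_def)
  have "total (concat (map (\<lambda>e. map (\<lambda>c. Disj (Neg (Var (e, c)) #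
      concat (map (\<lambda>f. if f \<noteq> e then map (\<lambda>d. Var (f, d)) colours else []) es))) colours) es))
      \<le> 4 * 24"
  proof (rule total_concat_le'[OF assms])
    show "total (map (\<lambda>c. Disj (Neg (Var (e, c)) #
        concat (map (\<lambda>f. if f \<noteq> e then map (\<lambda>d. Var (f, d)) colours else []) es))) colours) \<le> 24" for e
      using *[of e] by (simp add: colours_def)
  qed
  moreover have "total (concat (map (\<lambda>e. concat (map (\<lambda>f. concat (map (\<lambda>g. if distinct [e, f, g] then
      concat (map (\<lambda>c. concat (map (\<lambda>d. map (\<lambda>h.
        Disj [Neg (Var (e, c)), Neg (Var (f, d)), Neg (Var (g, h))]) colours) colours)) colours)
      else []) es)) es)) es)) \<le> 4 * (4 * (4 * 64))"
    by (intro total_concat_le'[OF assms]) (simp add: colours_def)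
  ultimately show ?thesis
    by (simp add: degree_zero_or_two_def)
qed

lemma set_corners: "2 \<le> n \<Longrightarrow> set (corners n) \<subseteq> set (grid_nodes n)"
  by (auto simp: corners_def blue_corners_def red_corners_def set_grid_nodes)

text \<open>Each of the \<open>n^2\<close> nodes has at most four slots and so contributes a
  constant. The corners add another constant, absorbed by \<open>4 \<le> n^2\<close>.\<close>

lemma symbols_STCONN_clauses:
  assumes "2 \<le> n"
  shows "symbols (Conj (STCONN_clauses n)) \<le> 10000 * n^2"
proof -
  have 1: "length (incident n v) \<le> 4" if "v \<in> set (corners n)" for v
    using that set_corners[OF assms] length_incident by blast
  have "total (concat (map (\<lambda>v. degree_one (incident n v)) (corners n))) \<le> 4 * 1000"
    by (rule total_concat_le') (auto simp: corners_def blue_corners_def red_corners_def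
        intro!: total_degree_one 1)
  moreover have "total (concat (map (\<lambda>v. touches Blue (incident n v)) (blue_corners n))) \<le> 2 * 5"
    by (rule total_concat_le') (auto simp: corners_def blue_corners_def
        intro!: total_touches 1)
  moreover have "total (concat (map (\<lambda>v. touches Red (incident n v)) (red_corners n))) \<le> 2 * 5"
    by (rule total_concat_le') (auto simp: corners_def red_corners_def
        intro!: total_touches 1)
  moreover have "total (concat (map (\<lambda>v. degree_zero_or_two (incident n v))
       (filter (\<lambda>v. v \<notin> set (corners n)) (grid_nodes n)))) \<le> n^2 * 4400"
    by (rule total_concat_le') (auto simp: length_grid_nodes[symmetric]
        intro!: total_degree_zero_or_two length_incident)
  moreover have "total (concat (map (\<lambda>v. not_both_colours (incident n v)) (grid_nodes n))) \<le> n^2 * 80"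
    by (rule total_concat_le') (auto simp: length_grid_nodes[symmetric]
        intro!: total_not_both_colours length_incident)
  moreover have "4 \<le> n^2"
    using power_mono[OF assms, of 2] by simp
  ultimately show ?thesis
    by (simp add: STCONN_clauses_def)
qed

lemma depth_STCONN_clauses: "depth (Conj (STCONN_clauses n)) \<le> 3"
proof -
  have "depth A \<le> 2" if "A \<in> set (STCONN_clauses n)" for A
    using that unfolding STCONN_clauses_def degree_one_def degree_zero_or_two_def touches_def
      not_both_colours_def
    by (auto simp: fold_max_le_iff)
  then show ?thesis
    by (simp add: fold_max_le_iff)
qed

subsection \<open>Meaning of the clauses\<close>

text \<open>The link between the semantics of the parity gate and the degrees of nodes.\<close>

lemma foldr_neq_card:
  "distinct xs \<Longrightarrow> foldr (\<noteq>) (map P xs) False \<longleftrightarrow> odd (card {x \<in> set xs. P x})"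
proof (induction xs)
  case (Cons x xs)
  have *: "{y \<in> set (x # xs). P y} = (if P x then insert x {y \<in> set xs. P y} else {y \<in> set xs. P y})"
    by auto
  show ?case unfolding * using Cons by simp
qed simp

lemma not_both_coloursD:
  assumes "\<forall>A \<in> set (not_both_colours es). eval w A" "e \<in> set es" "f \<in> set es" "w (e, c)" "w (f, d)"
  shows "c = d"
proof -
  have "\<not> (w (e, Blue) \<and> w (f, Red))" if "e \<in> set es" "f \<in> set es" for e f
    using assms(1) that by (force simp: not_both_colours_def)
  then show ?thesis
    using assms(2-) by (cases c; cases d) auto
qed

text \<open>If some slot has colour \<open>c\<close>, the first kind of clauses provides a second
  coloured slot, which has colour \<open>c\<close> as well because colours do not mix at a node. The
  second kind excludes a third, so the degree in colour \<open>c\<close> is 0 or 2.\<close>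

lemma degree_zero_or_two_even:
  assumes "\<forall>A \<in> set (degree_zero_or_two es @ not_both_colours es). eval w A"
  shows "even (card {e \<in> set es. w (e, c)})"
proof (cases "{e \<in> set es. w (e, c)} = {}")
  case False
  have col: "x \<in> set colours" for x
    by (cases x) (auto simp: colours_def)
  from False obtain e where e: "e \<in> set es" "w (e, c)" by blast
  have "Disj (Neg (Var (e, c)) # [Var (f, d). f \<leftarrow> es, f \<noteq> e, d \<leftarrow> colours])
      \<in> set (degree_zero_or_two es)"
    unfolding degree_zero_or_two_def set_append set_concat set_map
    by (rule UnI1, rule UN_I, rule imageI, rule e(1)) (simp only: set_map, rule imageI, rule col)
  then have "eval w (Disj (Neg (Var (e, c)) # [Var (f, d). f \<leftarrow> es, f \<noteq> e, d \<leftarrow> colours]))"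
    using assms unfolding set_append by blast
  with e obtain f d where f: "f \<in> set es" "f \<noteq> e" "w (f, d)"
    by auto
  moreover have "d = c"
    using not_both_coloursD[of es w f e d c] assms e f by simp
  moreover have "g = e \<or> g = f" if "g \<in> set es" "w (g, c)" for g
  proof (rule ccontr)
    assume "\<not> (g = e \<or> g = f)"
    with f(2) have dist: "distinct [e, f, g]" by auto
    have "Disj [Neg (Var (e, c)), Neg (Var (f, c)), Neg (Var (g, c))]
        \<in> set (degree_zero_or_two es)"
      unfolding degree_zero_or_two_def set_append set_concat set_map
      by (rule UnI2, rule UN_I, rule imageI, rule e(1), simp only: set_concat set_map,
          rule UN_I, rule imageI, rule f(1), simp only: set_concat set_map,
          rule UN_I, rule imageI, rule that(1), simp only: dist if_True set_concat set_map,
          rule UN_I, rule imageI, rule col, simp only: set_concat set_map,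
          rule UN_I, rule imageI, rule col, simp only: set_map, rule imageI, rule col)
    then have "eval w (Disj [Neg (Var (e, c)), Neg (Var (f, c)), Neg (Var (g, c))])"
      using assms unfolding set_append by blast
    with e f that \<open>d = c\<close> show False by simp
  qed
  ultimately have "{e \<in> set es. w (e, c)} = {e, f}"
    using e by auto
  with f(2) show ?thesis by simp
next
  case True
  then show ?thesis by (simp only: card.empty even_zero)
qed

text \<open>The slot that exists by \<open>touches\<close> is the only one of its colour, by
  \<open>degree_one\<close>, and it excludes the other colour at the node.\<close>

lemma degree_one_card:
  assumes "\<forall>A \<in> set (degree_one es @ touches c es @ not_both_colours es). eval w A"
  shows "card {e \<in> set es. w (e, d)} = (if d = c then 1 else 0)"
proof -
  have col: "x \<in> set colours" for x
    by (cases x) (auto simp: colours_def)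
  obtain e where e: "e \<in> set es" "w (e, c)"
    using assms by (auto simp: touches_def)
  have "f = e" if "f \<in> set es" "w (f, c)" for f
  proof (rule ccontr)
    assume neq: "f \<noteq> e"
    have "Disj [Neg (Var (f, c)), Neg (Var (e, c))] \<in> set (degree_one es)"
      unfolding degree_one_def set_append set_concat set_map
      by (rule UnI2, rule UN_I, rule imageI, rule that(1), simp only: set_concat set_map,
          rule UN_I, rule imageI, rule e(1),
          simp only: neq if_True not_False_eq_True set_concat set_map,
          rule UN_I, rule imageI, rule col, simp only: set_map, rule imageI, rule col)
    then have "eval w (Disj [Neg (Var (f, c)), Neg (Var (e, c))])"
      using assms unfolding set_append by blast
    with e that show False by simp
  qed
  with e have "{e \<in> set es. w (e, c)} = {e}" by blast
  moreover have "{e \<in> set es. w (e, d)} = {}" if "d \<noteq> c"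
  proof -
    have "\<forall>A \<in> set (not_both_colours es). eval w A"
      using assms unfolding set_append by blast
    then have "d = c" if "f \<in> set es" "w (f, d)" for f
      using not_both_coloursD[of es w f e d c] e that by blast
    with that show ?thesis by blast
  qed
  ultimately show ?thesis by auto
qed

definition corners_of :: "colour \<Rightarrow> nat \<Rightarrow> node list" where
  "corners_of c n = (case c of Blue \<Rightarrow> blue_corners n | Red \<Rightarrow> red_corners n)"

definition inner_clauses :: "edge list \<Rightarrow> var fm list" where
  "inner_clauses es = degree_zero_or_two es @ not_both_colours es"

definition corner_clauses :: "colour \<Rightarrow> edge list \<Rightarrow> var fm list" where
  "corner_clauses c es = degree_one es @ touches c es @ not_both_colours es"

lemma inner_clauses_subset:
  "v \<in> set (grid_nodes n) \<Longrightarrow> v \<notin> set (corners n) \<Longrightarrow>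
    set (inner_clauses (incident n v)) \<subseteq> set (STCONN_clauses n)"
  by (auto simp: inner_clauses_def STCONN_clauses_def)

lemma corner_clauses_subset:
  assumes "2 \<le> n" "v \<in> set (corners_of c n)"
  shows "set (corner_clauses c (incident n v)) \<subseteq> set (STCONN_clauses n)"
proof -
  have "v \<in> set (corners n)"
    using assms(2) by (cases c) (auto simp: corners_of_def corners_def)
  moreover from this have "v \<in> set (grid_nodes n)"
    using set_corners[OF assms(1)] by blast
  ultimately show ?thesis
    using assms(2) by (cases c) (auto simp: corners_of_def corner_clauses_def STCONN_clauses_def)
qed

lemma set_fm_clauses:
  assumes "A \<in> set (inner_clauses es) \<union> set (corner_clauses c es)"
  shows "set_fm A \<subseteq> set es \<times> UNIV"
  using assms unfolding inner_clauses_def corner_clauses_def degree_one_def degree_zero_or_two_def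
    touches_def not_both_colours_def
  by auto

section \<open>The counting argument\<close>

text \<open>A slot missing at the border of the grid is replaced by the false formula \<open>Par []\<close>. The formula
  \<open>side v\<close> below expresses $Q_v = 1$.\<close>

definition hleft :: "nat \<Rightarrow> nat \<Rightarrow> var fm" where
  "hleft i j = (if j = 0 then Par [] else Var (Horizontal i (j - 1), Red))"

definition vup :: "nat \<Rightarrow> nat \<Rightarrow> var fm" where
  "vup i j = (if i = 0 then Par [] else Var (Vertical (i - 1) j, Red))"

text \<open>The recursion on the row puts the new crossing at the head, so that
  \<open>par_Cons\<close> compares vertically adjacent nodes.\<close>

primrec crossings :: "nat \<Rightarrow> nat \<Rightarrow> var fm list" where
  "crossings 0 j = []"
| "crossings (Suc i) j = hleft i j # crossings i j"

definition side :: "node \<Rightarrow> var fm" where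
  "side v = Par (crossings (fst v) (snd v))"

text \<open>The summand $Q_v e_b$, with conjunction as the product over GF(2).\<close>

definition side_edge :: "node \<Rightarrow> edge \<Rightarrow> var fm" where
  "side_edge v e = Conj [side v, Var (e, Blue)]"

primrec ends :: "edge \<Rightarrow> node list" where
  "ends (Horizontal i j) = [(i, j), (i, Suc j)]"
| "ends (Vertical i j) = [(i, j), (Suc i, j)]"

lemma ends: "set (ends e) = endpoints e" "distinct (ends e)"
  by (cases e; simp)+

lemma symbols_crossings: "symbols (Par (crossings i j)) = Suc i"
  by (induction i) (auto simp: hleft_def)

lemma depth_crossings: "A \<in> set (crossings i j) \<Longrightarrow> depth A \<le> 1"
  by (induction i) (auto simp: hleft_def)

lemma depth_side: "depth (side v) \<le> 2"
  by (auto simp: side_def fold_max_le_iff depth_crossings[simplified])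

lemma symbols_side: "symbols (side v) = Suc (fst v)"
  by (simp add: side_def symbols_crossings del: symbols.simps)

definition by_edges :: "nat \<Rightarrow> var fm list" where
  "by_edges n = concat (map (\<lambda>e. map (\<lambda>v. side_edge v e) (ends e)) (grid_edges n))"

definition other_nodes :: "nat \<Rightarrow> node list" where
  "other_nodes n = filter (\<lambda>v. v \<noteq> (n - 1, n - 1)) (grid_nodes n)"

text \<open>The lower-right corner is put first, as its block is the only one with an odd
  sum.\<close>

definition by_nodes :: "nat \<Rightarrow> var fm list" where
  "by_nodes n = map (side_edge (n - 1, n - 1)) (incident n (n - 1, n - 1)) @
     concat (map (\<lambda>v. map (side_edge v) (incident n v)) (other_nodes n))"

section \<open>Double counting of incident pairs\<close>

lemma mset_concat_map: "mset (concat (map f xs)) = (\<Sum>x\<leftarrow>xs. mset (f x))"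
  by (induction xs) auto

lemma mset_map_sum_list: "mset (map f xs) = (\<Sum>x\<leftarrow>xs. {#f x#})"
  by (induction xs) auto

text \<open>Both lists run through all pairs of a node and an edge incident to it. As multisets they
  are double sums with the order of summation exchanged.\<close>

lemma mset_by_nodes:
  assumes "2 \<le> n"
  shows "mset (by_nodes n) = mset (by_edges n)"
proof -
  let ?V = "set (grid_nodes n)" and ?E = "set (grid_edges n)"
  have inc: "mset (map (side_edge v) (incident n v)) =
      (\<Sum>e\<in>?E. if v \<in> endpoints e then {#side_edge v e#} else {#})" for v
  proof -
    have "mset (map (side_edge v) (incident n v)) = (\<Sum>e\<leftarrow>incident n v. {#side_edge v e#})"
      by (rule mset_map_sum_list)
    also have "\<dots> = (\<Sum>e\<in>set (incident n v). {#side_edge v e#})"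
      by (rule sum_list_distinct_conv_sum_set[OF distinct_incident])
    also have "\<dots> = (\<Sum>e\<in>?E. if v \<in> endpoints e then {#side_edge v e#} else {#})"
      unfolding incident_def set_filter by (rule sum.inter_filter) simp
    finally show ?thesis .
  qed
  have nodes: "set ((n - 1, n - 1) # other_nodes n) = ?V" "distinct ((n - 1, n - 1) # other_nodes n)"
    using assms by (auto simp: other_nodes_def set_grid_nodes distinct_grid_nodes)
  have "mset (by_nodes n) = mset (concat (map (\<lambda>v. map (side_edge v) (incident n v)) ((n - 1, n - 1) # other_nodes n)))"
    by (simp add: by_nodes_def)
  also have "\<dots> = (\<Sum>v\<in>?V. mset (map (side_edge v) (incident n v)))"
    unfolding mset_concat_map sum_list_distinct_conv_sum_set[OF nodes(2)] nodes(1) ..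
  also have "\<dots> = (\<Sum>v\<in>?V. \<Sum>e\<in>?E. if v \<in> endpoints e then {#side_edge v e#} else {#})"
    by (simp only: inc)
  also have "\<dots> = (\<Sum>e\<in>?E. \<Sum>v\<in>?V. if v \<in> endpoints e then {#side_edge v e#} else {#})"
    by (rule sum.swap)
  also have "\<dots> = (\<Sum>e\<in>?E. mset (map (\<lambda>v. side_edge v e) (ends e)))"
  proof (rule sum.cong[OF refl])
    fix e assume "e \<in> ?E"
    then have "endpoints e \<subseteq> ?V"
      by (auto simp: set_grid_edges set_grid_nodes)
    then have "{v \<in> ?V. v \<in> endpoints e} = endpoints e" by blast
    moreover have "(\<Sum>v\<in>?V. if v \<in> endpoints e then {#side_edge v e#} else {#}) =
        (\<Sum>v\<in>{v \<in> ?V. v \<in> endpoints e}. {#side_edge v e#})"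
      by (rule sum.inter_filter[symmetric]) simp
    ultimately show "(\<Sum>v\<in>?V. if v \<in> endpoints e then {#side_edge v e#} else {#}) =
        mset (map (\<lambda>v. side_edge v e) (ends e))"
      by (cases e) auto
  qed
  also have "\<dots> = mset (by_edges n)"
    unfolding by_edges_def mset_concat_map sum_list_distinct_conv_sum_set[OF distinct_grid_edges] ..
  finally show ?thesis .
qed

lemma length_by_edges: "length (by_edges n) \<le> 4 * n^2"
proof -
  have "length (by_edges n) = 2 * length (grid_edges n)"
  proof -
    have "length (ends e) = 2" for e by (cases e) auto
    then show ?thesis
      by (simp add: by_edges_def length_concat comp_def sum_list_triv)
  qed
  with length_grid_edges[of n] show ?thesis by simp
qed

text \<open>Depth 4 is that of \<open>Par (by_edges n)\<close>: a parity of conjunctions of parities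
  whose inputs may be \<open>Par []\<close>. The bound \<open>M\<close> covers this formula, of
  cubic size, and the clauses, of quadratic size.\<close>

locale stconn = bounded_frege N 4 M "Conj (STCONN_clauses n)" for N M n +
  assumes n_ge: "2 \<le> n" and M_eq: "M = 20000 * n^3"
begin

section \<open>Sizes of the formulas substituted for letters\<close>

lemma n_le_M: "n \<le> n^2" "n^2 \<le> n^3" "20000 * n \<le> M" "20000 \<le> M"
proof -
  show *: "n \<le> n^2" "n^2 \<le> n^3"
    using n_ge by (auto simp: power2_eq_square power3_eq_cube)
  then have "n \<le> n^3" by linarith
  with n_ge show "20000 * n \<le> M" "20000 \<le> M"
    by (auto simp: M_eq)
qed

lemma small_Var: "small (Var x)"
  using n_le_M by (simp add: small_def)

lemma small_hleft: "small (hleft i j)" and small_vup: "small (vup i j)"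
  using n_le_M by (auto simp: small_def hleft_def vup_def)

lemma small_side: "i < n \<Longrightarrow> small (side (i, j))"
  using depth_side[of "(i, j)"] n_le_M n_ge by (simp add: small_def symbols_side)

lemma small_crossings: "i < n \<Longrightarrow> small (Par (crossings i j))"
  using small_side[of i j] by (simp add: side_def)

lemma small_by_edges: "small (Par (by_edges n))"
proof -
  \<comment> \<open>As \<open>fst v < n\<close>, the formula \<open>side v\<close> has at most
    \<open>n\<close> symbols; the conjunction and the variable add two.\<close>
  have sym: "symbols A \<le> n + 2" and dep: "depth A \<le> 3" if "A \<in> set (by_edges n)" for A
  proof -
    have "\<exists>e \<in> set (grid_edges n). \<exists>v \<in> endpoints e. A = side_edge v e"
      using that by (simp add: by_edges_def ends image_iff)
    then obtain e v where e: "e \<in> set (grid_edges n)" "v \<in> endpoints e" and A: "A = side_edge v e"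
      by blast
    then have "fst v < n"
      by (auto simp: set_grid_edges)
    then show "symbols A \<le> n + 2"
      by (simp add: A side_edge_def symbols_side)
    show "depth A \<le> 3"
      using depth_side[of v] by (simp add: A side_edge_def)
  qed
  have "sum_list (map symbols (by_edges n)) \<le> length (by_edges n) * (n + 2)"
    using sum_list_mono[of "by_edges n" symbols "\<lambda>_. n + 2"] sym by (simp add: sum_list_triv)
  also have "\<dots> \<le> 4 * n^2 * (n + 2)"
    using length_by_edges by (rule mult_le_mono1)
  also have "\<dots> = 4 * n^3 + 8 * n^2"
    by (simp add: algebra_simps power2_eq_square power3_eq_cube)
  finally have "Suc (total (by_edges n)) \<le> M"
    using n_le_M(2,4) unfolding M_eq by linarith
  then have "symbols (Par (by_edges n)) \<le> M"
    by simp
  moreover have "depth (Par (by_edges n)) \<le> 4"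
    using dep by (auto simp: fold_max_le_iff)
  ultimately show ?thesis by (simp add: small_def)
qed

lemma small_by_nodes: "small (Par (by_nodes n))"
  using small_by_edges small_Par_mset[OF mset_by_nodes[OF n_ge]] by simp

text \<open>The hypothesis is the conjunction of all clauses, so the implication to a single clause
  is an instance of \<open>Conj_elim\<close>.\<close>

lemma proves_clause:
  assumes "A \<in> set (STCONN_clauses n)"
  shows "proves 1 A"
proof -
  have "symbols A \<le> M"
    using assms symbols_C member_le_sum_list[of "symbols A" "map symbols (STCONN_clauses n)"] by auto
  moreover have "depth A \<le> 4"
    using assms depth_C by (auto simp: fold_max_le_iff)
  moreover have "40 * M \<le> N * M"
    using N_ge by (rule mult_le_mono1)
  with \<open>symbols A \<le> M\<close> symbols_C n_le_M(4)
  have "Suc (Suc (symbols (Conj (STCONN_clauses n)) + symbols A)) \<le> N * M"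
    by linarith
  ultimately show ?thesis
    unfolding proves_def using assms depth_C symbols_C N_ge n_le_M
    by (intro prv_axiom) (auto intro: AC0_axiom.intros simp del: depth.simps(3) symbols.simps(3))
qed

text \<open>At most four slots meet at a node, giving at most eight variables and clauses of bounded
  total size. Hence a short formula that follows semantically from the clauses at one node costs
  only \<open>K\<close> lines.\<close>

lemma local_consequence:
  assumes v: "v \<in> set (grid_nodes n)"
    and clauses: "set As \<subseteq> set (STCONN_clauses n)"
      "As = inner_clauses (incident n v) \<or> As = corner_clauses c (incident n v)"
    and B: "set_fm B \<subseteq> set (incident n v) \<times> UNIV" "symbols B \<le> 100"
    and valid: "\<And>w. (\<forall>A \<in> set As. eval w A) \<Longrightarrow> eval w B"
  shows "proves K B"
proof (rule tautological_step_local)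
  note len = length_incident[OF v]
  show "finite (set (incident n v) \<times> (UNIV :: colour set))"
    "card (set (incident n v) \<times> (UNIV :: colour set)) < 20"
  proof -
    have U: "(UNIV :: colour set) = {Blue, Red}"
      using colour.exhaust by auto
    show "finite (set (incident n v) \<times> (UNIV :: colour set))"
      by (simp add: U)
    show "card (set (incident n v) \<times> (UNIV :: colour set)) < 20"
      using len card_length[of "incident n v"] by (simp add: U card_cartesian_product)
  qed
  show "set_fm A \<subseteq> set (incident n v) \<times> UNIV" if "A \<in> set (B # As)" for A
    using that B(1) clauses(2) set_fm_clauses by fastforce
  have "total As \<le> 5000"
    using clauses(2) total_degree_one[OF len] total_touches[OF len, of c]
      total_not_both_colours[OF len] total_degree_zero_or_two[OF len]
    by (auto simp: inner_clauses_def corner_clauses_def)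
  then show "7 * total As + symbols B \<le> 49000"
    using B(2) by simp
qed (use clauses valid proves_clause small_Var in auto)

section \<open>Degree conditions in one colour\<close>

lemma corners_of_nodes: "v \<in> set (corners_of c n) \<Longrightarrow> v \<in> set (grid_nodes n)"
  using n_ge by (cases c) (auto simp: corners_of_def blue_corners_def red_corners_def set_grid_nodes)

text \<open>A node that is no corner of colour \<open>c\<close> is either a corner of the other
  colour, with \<open>c\<close>-degree 0, or an ordinary node, with \<open>c\<close>-degree 0 or
  2.\<close>

lemma even_degree:
  assumes v: "v \<in> set (grid_nodes n)" "v \<notin> set (corners_of c n)"
    and B: "set_fm B \<subseteq> set (incident n v) \<times> UNIV" "symbols B \<le> 100"
    and valid: "\<And>w. even (card {e \<in> set (incident n v). w (e, c)}) \<Longrightarrow> eval w B"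
  shows "proves K B"
proof (cases "v \<in> set (corners n)")
  case True
  then obtain c' where c': "v \<in> set (corners_of c' n)" "c' \<noteq> c"
    using v(2) by (cases c) (force simp: corners_def corners_of_def split: colour.splits)+
  show ?thesis
  proof (rule local_consequence[OF v(1) corner_clauses_subset[OF n_ge c'(1)] disjI2[OF refl] B])
    show "eval w B" if "\<forall>A \<in> set (corner_clauses c' (incident n v)). eval w A" for w
    proof (rule valid)
      have "card {e \<in> set (incident n v). w (e, c)} = 0"
        using degree_one_card[of "incident n v" c' w c] that c'(2) unfolding corner_clauses_def
        by presburger
      then show "even (card {e \<in> set (incident n v). w (e, c)})"
        by presburger
    qed
  qed
next
  case False
  show ?thesis
  proof (rule local_consequence[OF v(1) inner_clauses_subset[OF v(1) False] disjI1[OF refl] B])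
    show "eval w B" if "\<forall>A \<in> set (inner_clauses (incident n v)). eval w A" for w
      using degree_zero_or_two_even[of "incident n v" w c] that valid by (simp add: inner_clauses_def)
  qed
qed

lemma odd_degree:
  assumes v: "v \<in> set (corners_of c n)"
    and B: "set_fm B \<subseteq> set (incident n v) \<times> UNIV" "symbols B \<le> 100"
    and valid: "\<And>w. odd (card {e \<in> set (incident n v). w (e, c)}) \<Longrightarrow> eval w B"
  shows "proves K B"
proof (rule local_consequence[OF corners_of_nodes[OF v] corner_clauses_subset[OF n_ge v] disjI2[OF refl] B])
  show "eval w B" if "\<forall>A \<in> set (corner_clauses c (incident n v)). eval w A" for w
    using degree_one_card[of "incident n v" c w c] that valid by (simp add: corner_clauses_def)
qed

lemma card_incident:
  assumes "i < n" "j < n"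
  shows "odd (card {e \<in> set (incident n (i, j)). w (e, c)}) \<longleftrightarrow>
    foldr (\<noteq>) (map (\<lambda>e. w (e, c)) (incident_explicit n i j)) False"
  unfolding set_incident[OF assms] foldr_neq_card[OF distinct_incident_explicit] ..

lemma even_card_incident:
  assumes "i < n" "j < n"
  shows "even (card {e \<in> set (incident n (i, j)). w (e, c)}) \<longleftrightarrow>
    \<not> foldr (\<noteq>) (map (\<lambda>e. w (e, c)) (incident_explicit n i j)) False"
  using card_incident[OF assms, of w c] by blast

lemma disjoint_colours:
  assumes "v \<in> set (grid_nodes n)" "e \<in> set (incident n v)" "f \<in> set (incident n v)"
  shows "proves K (Imp (Var (e, Blue)) (Neg (Var (f, Red))))"
proof (rule proves_mono)
  have "Imp (Var (e, Blue)) (Neg (Var (f, Red))) \<in> set (not_both_colours (incident n v))"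
    using assms by (auto simp: not_both_colours_def)
  with assms(1) show "proves 1 (Imp (Var (e, Blue)) (Neg (Var (f, Red))))"
    by (intro proves_clause) (auto simp: STCONN_clauses_def)
qed (simp add: K_def)

text \<open>The four formulas are the slots above, below, left and right of \<open>(i, j)\<close>.
  Avoiding the last row and column excludes both red corners; the upper-left corner is included, as
  its red degree is 0.\<close>

lemma red_inner:
  assumes "i < n - 1" "j < n - 1"
  shows "proves K (Neg (Par [vup i j, vup (Suc i) j, hleft i j, hleft i (Suc j)]))"
proof (rule even_degree)
  have ij: "i < n" "j < n" using assms by auto
  show "(i, j) \<in> set (grid_nodes n)" using ij by (simp add: set_grid_nodes)
  show "(i, j) \<notin> set (corners_of Red n)"
    using assms by (auto simp: corners_of_def red_corners_def)
  show "set_fm (Neg (Par [vup i j, vup (Suc i) j, hleft i j, hleft i (Suc j)]))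
      \<subseteq> set (incident n (i, j)) \<times> UNIV"
    using assms unfolding set_incident[OF ij] by (auto simp: incident_explicit_def vup_def hleft_def)
  show "symbols (Neg (Par [vup i j, vup (Suc i) j, hleft i j, hleft i (Suc j)])) \<le> 100"
    by (simp add: vup_def hleft_def)
  show "eval w (Neg (Par [vup i j, vup (Suc i) j, hleft i j, hleft i (Suc j)]))"
    if "even (card {e \<in> set (incident n (i, j)). w (e, Red)})" for w
    using that assms unfolding even_card_incident[OF ij]
    by (auto simp: incident_explicit_def vup_def hleft_def split: if_splits)
qed

lemma red_last_column:
  assumes "0 < i" "i < n - 1"
  shows "proves K (Neg (Par [vup i (n - 1), vup (Suc i) (n - 1), hleft i (n - 1)]))"
proof (rule even_degree)
  have ij: "i < n" "n - 1 < n" using assms by auto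
  show "(i, n - 1) \<in> set (grid_nodes n)" using ij by (simp add: set_grid_nodes)
  show "(i, n - 1) \<notin> set (corners_of Red n)"
    using assms by (auto simp: corners_of_def red_corners_def)
  show "set_fm (Neg (Par [vup i (n - 1), vup (Suc i) (n - 1), hleft i (n - 1)]))
      \<subseteq> set (incident n (i, n - 1)) \<times> UNIV"
    using assms unfolding set_incident[OF ij] by (auto simp: incident_explicit_def vup_def hleft_def)
  show "symbols (Neg (Par [vup i (n - 1), vup (Suc i) (n - 1), hleft i (n - 1)])) \<le> 100"
    by (simp add: vup_def hleft_def)
  show "eval w (Neg (Par [vup i (n - 1), vup (Suc i) (n - 1), hleft i (n - 1)]))"
    if "even (card {e \<in> set (incident n (i, n - 1)). w (e, Red)})" for w
    using that assms unfolding even_card_incident[OF ij]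
    by (auto simp: incident_explicit_def vup_def hleft_def split: if_splits)
qed

lemma red_upper_right: "proves K (Par [vup 1 (n - 1), hleft 0 (n - 1)])"
proof (rule odd_degree)
  have ij: "0 < n" "n - 1 < n" using n_ge by auto
  show "(0, n - 1) \<in> set (corners_of Red n)"
    by (auto simp: corners_of_def red_corners_def)
  show "set_fm (Par [vup 1 (n - 1), hleft 0 (n - 1)]) \<subseteq> set (incident n (0, n - 1)) \<times> UNIV"
    using n_ge unfolding set_incident[OF ij] by (auto simp: incident_explicit_def vup_def hleft_def)
  show "symbols (Par [vup 1 (n - 1), hleft 0 (n - 1)]) \<le> 100"
    by (simp add: vup_def hleft_def)
  show "eval w (Par [vup 1 (n - 1), hleft 0 (n - 1)])"
    if "odd (card {e \<in> set (incident n (0, n - 1)). w (e, Red)})" for w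
    using that n_ge unfolding card_incident[OF ij]
    by (auto simp: incident_explicit_def vup_def hleft_def split: if_splits)
qed

text \<open>A single slot has to vanish here, which even red degree would not give. A blue corner
  has no red edge at all.\<close>

lemma red_lower_right: "proves K (Neg (vup (n - 1) (n - 1)))"
proof (rule local_consequence)
  have ij: "n - 1 < n" "n - 1 < n" using n_ge by auto
  have v: "(n - 1, n - 1) \<in> set (corners_of Blue n)"
    by (auto simp: corners_of_def blue_corners_def)
  show "(n - 1, n - 1) \<in> set (grid_nodes n)" using ij by (simp add: set_grid_nodes)
  show "set (corner_clauses Blue (incident n (n - 1, n - 1))) \<subseteq> set (STCONN_clauses n)"
    by (rule corner_clauses_subset[OF n_ge v])
  show "set_fm (Neg (vup (n - 1) (n - 1))) \<subseteq> set (incident n (n - 1, n - 1)) \<times> UNIV"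
    using n_ge unfolding set_incident[OF ij] by (auto simp: incident_explicit_def vup_def)
  show "eval w (Neg (vup (n - 1) (n - 1)))"
    if "\<forall>A \<in> set (corner_clauses Blue (incident n (n - 1, n - 1))). eval w A" for w
  proof -
    have "card {e \<in> set (incident n (n - 1, n - 1)). w (e, Red)} = 0"
      using degree_one_card[of "incident n (n - 1, n - 1)" Blue w Red] that
      by (simp add: corner_clauses_def)
    then have "\<not> w (e, Red)" if "e \<in> set (incident n (n - 1, n - 1))" for e
      using that by auto
    then show ?thesis
      using n_ge unfolding set_incident[OF ij] by (auto simp: incident_explicit_def vup_def)
  qed
  show "symbols (Neg (vup (n - 1) (n - 1))) \<le> 100"
    by (simp add: vup_def)
qed (rule disjI2, rule refl)

section \<open>The parity $Q$ at adjacent nodes\<close>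

lemma side_Suc:
  assumes "Suc i < n"
  shows "proves K (Neg (Par [side (Suc i, j), hleft i j, side (i, j)]))"
  using par_Cons[of "hleft i j" "crossings i j"] small_crossings[OF assms, of j]
  by (simp add: side_def)

text \<open>The sum of the red degree equations of the nodes of column \<open>j\<close> above row
  \<open>i\<close>. Their vertical edges cancel except for the lowest one, \<open>vup i j\<close>,
  and the horizontal ones form the two crossing parities.\<close>

lemma side_horizontal:
  assumes "i < n" "j < n - 1"
  shows "proves (6 * K * (i + 1)) (Neg (Par [side (i, j), side (i, Suc j), vup i j]))"
  using assms(1)
proof (induction i)
  case 0
  show ?case
    by (intro tautological_step[where ks = "[]" and Xs = "[]" and As = "[]"
          and B = "Neg (Par [Par [], Par [], Par []])"])
      (auto simp: K_def side_def vup_def)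
next
  case (Suc i)
  note small = small_side[of i j] small_side[of i "Suc j"] small_side[of "Suc i" j]
    small_side[of "Suc i" "Suc j"] small_vup small_hleft
  have "proves K (Neg (Par [side (Suc i, j), hleft i j, side (i, j)]))"
    "proves K (Neg (Par [side (Suc i, Suc j), hleft i (Suc j), side (i, Suc j)]))"
    "proves K (Neg (Par [vup i j, vup (Suc i) j, hleft i j, hleft i (Suc j)]))"
    "proves (6 * K * (i + 1)) (Neg (Par [side (i, j), side (i, Suc j), vup i j]))"
    using Suc assms(2) side_Suc red_inner by auto
  then show ?case
    by (intro tautological_step[where ks = "[K, K, K, 6 * K * (i + 1)]"
          and Xs = "[side (i, j), side (i, Suc j), side (Suc i, j), side (Suc i, Suc j), hleft i j,
            hleft i (Suc j), vup i j, vup (Suc i) j]"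
          and As = "[Neg (Par [Var 2, Var 4, Var 0]), Neg (Par [Var 3, Var 5, Var 1]),
            Neg (Par [Var 6, Var 7, Var 4, Var 5]), Neg (Par [Var 0, Var 1, Var 6])]"
          and B = "Neg (Par [Var 2, Var 3, Var 7])"])
      (use small Suc.prems in \<open>auto simp: inst_def K_def\<close>)
qed

text \<open>The same summation in the last column, where no slots lead to the right. The upper-right
  corner contributes an odd degree, so the sum is 1; the rows start at 1 to have this corner
  included.\<close>

lemma side_last_column:
  assumes "Suc i < n"
  shows "proves (6 * K * (i + 1)) (Par [side (Suc i, n - 1), vup (Suc i) (n - 1)])"
  using assms
proof (induction i)
  case 0
  note small = small_side[of 0 "n - 1"] small_side[of 1 "n - 1"] small_vup small_hleft
  have "proves K (Neg (Par [side (1, n - 1), hleft 0 (n - 1), Par []]))"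
    "proves K (Par [vup 1 (n - 1), hleft 0 (n - 1)])"
    using side_Suc[OF 0, of "n - 1"] red_upper_right by (simp_all add: side_def[of "(0, _)"])
  then show ?case
    by (intro tautological_step[where ks = "[K, K]"
          and Xs = "[side (1, n - 1), vup 1 (n - 1), hleft 0 (n - 1)]"
          and As = "[Neg (Par [Var 0, Var 2, Par []]), Par [Var 1, Var 2]]"
          and B = "Par [Var 0, Var 1]"])
      (use small n_ge in \<open>auto simp: inst_def K_def\<close>)
next
  case (Suc i)
  note small = small_side[of "Suc i" "n - 1"] small_side[of "Suc (Suc i)" "n - 1"] small_vup small_hleft
  have "proves K (Neg (Par [side (Suc (Suc i), n - 1), hleft (Suc i) (n - 1), side (Suc i, n - 1)]))"
    "proves K (Neg (Par [vup (Suc i) (n - 1), vup (Suc (Suc i)) (n - 1), hleft (Suc i) (n - 1)]))"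
    "proves (6 * K * (i + 1)) (Par [side (Suc i, n - 1), vup (Suc i) (n - 1)])"
    using Suc side_Suc red_last_column by auto
  then show ?case
    by (intro tautological_step[where ks = "[K, K, 6 * K * (i + 1)]"
          and Xs = "[side (Suc i, n - 1), side (Suc (Suc i), n - 1), vup (Suc i) (n - 1),
            vup (Suc (Suc i)) (n - 1), hleft (Suc i) (n - 1)]"
          and As = "[Neg (Par [Var 1, Var 4, Var 0]), Neg (Par [Var 2, Var 3, Var 4]),
            Par [Var 0, Var 2]]"
          and B = "Par [Var 1, Var 3]"])
      (use small Suc.prems in \<open>auto simp: inst_def K_def\<close>)
qed

lemma side_lower_right: "proves (9 * K * n) (side (n - 1, n - 1))"
proof -
  have "proves (6 * K * (n - 1)) (Par [side (n - 1, n - 1), vup (n - 1) (n - 1)])"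
    using side_last_column[of "n - 2"] n_ge by (simp add: numeral_2_eq_2 Suc_diff_Suc)
  moreover note red_lower_right
  moreover have "6 * K * (n - 1) + 3 * K \<le> 9 * K * n"
    using n_ge by (cases n) auto
  ultimately show ?thesis
    by (intro tautological_step[where ks = "[6 * K * (n - 1), K]"
          and Xs = "[side (n - 1, n - 1), vup (n - 1) (n - 1)]"
          and As = "[Par [Var 0, Var 1], Neg (Var 1)]" and B = "Var 0"])
      (use small_side n_ge small_vup in \<open>auto simp: inst_def K_def\<close>)
qed

text \<open>The values of $Q$ at the ends of \<open>e\<close> differ by one red slot that meets
  \<open>e\<close> at \<open>(i, j)\<close>: the one above for a horizontal edge, the one to the
  left for a vertical edge. If \<open>e\<close> is blue, this slot is not red and the two summands
  cancel; otherwise both are 0.\<close>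

lemma edge_sum:
  assumes "e \<in> set (grid_edges n)"
  shows "proves (9 * K * n) (Neg (Par (map (\<lambda>v. side_edge v e) (ends e))))"
proof -
  consider (H) i j where "e = Horizontal i j" "i < n" "j < n - 1"
    | (V) i j where "e = Vertical i j" "i < n - 1" "j < n"
    using assms by (auto simp: set_grid_edges)
  then show ?thesis
  proof cases
    case H
    have "proves K (Imp (Var (e, Blue)) (Neg (vup i j)))"
    proof (cases "i = 0")
      case True
      then show ?thesis
        by (intro tautological_step[where ks = "[]" and Xs = "[Var (e, Blue)]" and As = "[]"
              and B = "Imp (Var 0) (Neg (Par []))"])
          (auto simp: inst_def K_def vup_def small_Var)
    next
      case False
      then show ?thesis
        using disjoint_colours[of "(i, j)" e "Vertical (i - 1) j"] H set_incident[of i n j]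
        by (simp add: vup_def set_grid_nodes incident_explicit_def)
    qed
    moreover have "proves (6 * K * (i + 1)) (Neg (Par [side (i, j), side (i, Suc j), vup i j]))"
      using H by (intro side_horizontal)
    moreover have "6 * K * (i + 1) + 3 * K \<le> 9 * K * n"
    proof -
      have "6 * K * (i + 1) \<le> 6 * K * n" "3 * K \<le> 3 * K * n"
        using H by (simp_all del: add_Suc_right)
      then show ?thesis by linarith
    qed
    ultimately show ?thesis
      by (intro tautological_step[where ks = "[K, 6 * K * (i + 1)]"
            and Xs = "[side (i, j), side (i, Suc j), vup i j, Var (e, Blue)]"
            and As = "[Imp (Var 3) (Neg (Var 2)), Neg (Par [Var 0, Var 1, Var 2])]"
            and B = "Neg (Par [Conj [Var 0, Var 3], Conj [Var 1, Var 3]])"])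
        (use H small_side small_vup small_Var in \<open>auto simp: inst_def K_def side_edge_def\<close>)
  next
    case V
    have "proves K (Imp (Var (e, Blue)) (Neg (hleft i j)))"
    proof (cases "j = 0")
      case True
      then show ?thesis
        by (intro tautological_step[where ks = "[]" and Xs = "[Var (e, Blue)]" and As = "[]"
              and B = "Imp (Var 0) (Neg (Par []))"])
          (auto simp: inst_def K_def hleft_def small_Var)
    next
      case False
      then show ?thesis
        using disjoint_colours[of "(i, j)" e "Horizontal i (j - 1)"] V set_incident[of i n j]
        by (simp add: hleft_def set_grid_nodes incident_explicit_def)
    qed
    moreover have "proves K (Neg (Par [side (Suc i, j), hleft i j, side (i, j)]))"
      using V by (intro side_Suc) simp
    moreover have "3 * K \<le> 9 * K * n"
      using n_ge by simp
    ultimately show ?thesis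
      by (intro tautological_step[where ks = "[K, K]"
            and Xs = "[side (i, j), side (Suc i, j), hleft i j, Var (e, Blue)]"
            and As = "[Imp (Var 3) (Neg (Var 2)), Neg (Par [Var 1, Var 2, Var 0])]"
            and B = "Neg (Par [Conj [Var 0, Var 3], Conj [Var 1, Var 3]])"])
        (use V small_side small_hleft small_Var in \<open>auto simp: inst_def K_def side_edge_def\<close>)
  qed
qed

section \<open>Sums over the edges at a node\<close>

lemma foldr_conj:
  "foldr (\<lambda>x y. x = (\<not> y)) (map (\<lambda>x. a \<and> P x) xs) False \<longleftrightarrow>
    a \<and> foldr (\<lambda>x y. x = (\<not> y)) (map P xs) False"
  by (induction xs) auto

lemma foldr_False: "\<not> foldr (\<lambda>x y. x = (\<not> y)) (map (\<lambda>x. False) xs) False"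
  by (induction xs) auto

text \<open>Letter 0 stands for $Q_v$ and the following letters for the blue variables at
  \<open>v\<close>. So the distributive law at \<open>v\<close> is an instance of a tautology that
  depends only on the number of slots, at most four.\<close>

lemma node_sum_inst:
  assumes v: "v \<in> set (grid_nodes n)"
  defines "es \<equiv> incident n v"
  defines "Xs \<equiv> side v # map (\<lambda>e. Var (e, Blue)) es"
  shows "Par (map (\<lambda>e. Var (e, Blue)) es) =
      subst (inst Xs) (Par (map (\<lambda>i. Var (Suc i)) [0..<length es]))" (is ?P)
    and "Par (map (side_edge v) es) =
      subst (inst Xs) (Par (map (\<lambda>i. Conj [Var 0, Var (Suc i)]) [0..<length es]))" (is ?S)
    and "length Xs < 20" "\<And>X. X \<in> set Xs \<Longrightarrow> small X" "length es \<le> 4"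
proof -
  show ?P ?S
    by (auto simp: Xs_def inst_def side_edge_def comp_def intro!: nth_equalityI)
  show "length es \<le> 4"
    unfolding es_def by (rule length_incident[OF v])
  then show "length Xs < 20"
    by (simp add: Xs_def)
  show "small X" if "X \<in> set Xs" for X
    using that small_Var small_side v by (auto simp: Xs_def set_grid_nodes)
qed

lemma blue_even:
  assumes "v \<in> set (grid_nodes n)" "v \<notin> set (corners_of Blue n)"
  shows "proves K (Neg (Par (map (\<lambda>e. Var (e, Blue)) (incident n v))))"
proof (rule even_degree[OF assms])
  show "symbols (Neg (Par (map (\<lambda>e. Var (e, Blue)) (incident n v)))) \<le> 100"
    using length_incident[OF assms(1)] by (simp add: comp_def sum_list_triv)
  show "eval w (Neg (Par (map (\<lambda>e. Var (e, Blue)) (incident n v))))"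
    if "even (card {e \<in> set (incident n v). w (e, Blue)})" for w
    using that foldr_neq_card[OF distinct_incident[of n v], of "\<lambda>e. w (e, Blue)"]
    by (simp add: comp_def)
qed auto

lemma blue_odd:
  assumes "v \<in> set (corners_of Blue n)"
  shows "proves K (Par (map (\<lambda>e. Var (e, Blue)) (incident n v)))"
proof (rule odd_degree[OF assms])
  show "symbols (Par (map (\<lambda>e. Var (e, Blue)) (incident n v))) \<le> 100"
    using length_incident[OF corners_of_nodes[OF assms]] by (simp add: comp_def sum_list_triv)
  show "eval w (Par (map (\<lambda>e. Var (e, Blue)) (incident n v)))"
    if "odd (card {e \<in> set (incident n v). w (e, Blue)})" for w
    using that foldr_neq_card[OF distinct_incident[of n v], of "\<lambda>e. w (e, Blue)"]
    by (simp add: comp_def)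
qed auto

text \<open>The common factor $Q_v$ is taken out of the sum, which leaves the blue degree modulo 2.
  One of the two factors vanishes at each of these nodes.\<close>

lemma node_sum_even:
  assumes v: "v \<in> set (other_nodes n)"
  shows "proves (2 * K) (Neg (Par (map (side_edge v) (incident n v))))"
proof -
  have v': "v \<in> set (grid_nodes n)" "v \<noteq> (n - 1, n - 1)"
    using v by (auto simp: other_nodes_def)
  note inst = node_sum_inst[OF v'(1)]
  let ?P = "Par (map (\<lambda>i. Var (Suc i)) [0..<length (incident n v)])"
  let ?S = "Par (map (\<lambda>i. Conj [Var 0, Var (Suc i)]) [0..<length (incident n v)])"
  show ?thesis
  proof (cases "v = (0, 0)")
    case True
    \<comment> \<open>The blue degree is odd at this corner, but no row lies above it, so $Q_v$ is
      the empty parity.\<close>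
    have "proves K (Neg (side v))"
      by (intro tautological_step[where ks = "[]" and Xs = "[]" and As = "[]" and B = "Neg (Par [])"])
        (auto simp: K_def side_def True)
    then show ?thesis
      by (intro tautological_step[where ks = "[K]" and As = "[Neg (Var 0)]" and B = "Neg ?S"
            and Xs = "side v # map (\<lambda>e. Var (e, Blue)) (incident n v)"])
        (use inst in \<open>auto simp: inst_def[of _ 0] K_def comp_def foldr_False sum_list_triv\<close>)
  next
    case False
    then have "v \<notin> set (corners_of Blue n)"
      using v'(2) by (auto simp: corners_of_def blue_corners_def)
    with v'(1) have "proves K (Neg (Par (map (\<lambda>e. Var (e, Blue)) (incident n v))))"
      by (rule blue_even)
    then show ?thesis
      unfolding inst(1)
      by (intro tautological_step[where ks = "[K]" and As = "[Neg ?P]" and B = "Neg ?S"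
            and Xs = "side v # map (\<lambda>e. Var (e, Blue)) (incident n v)"])
        (use inst in \<open>auto simp: K_def comp_def foldr_conj sum_list_triv\<close>)
  qed
qed

text \<open>Both factors are 1 here: $Q$ by \<open>side_lower_right\<close> and the blue degree by
  \<open>blue_odd\<close>.\<close>

lemma node_sum_odd:
  "proves (12 * K * n) (Par (map (side_edge (n - 1, n - 1)) (incident n (n - 1, n - 1))))"
proof -
  let ?v = "(n - 1, n - 1)"
  have v: "?v \<in> set (corners_of Blue n)"
    by (auto simp: corners_of_def blue_corners_def)
  note inst = node_sum_inst[OF corners_of_nodes[OF v]]
  let ?P = "Par (map (\<lambda>i. Var (Suc i)) [0..<length (incident n ?v)])"
  let ?S = "Par (map (\<lambda>i. Conj [Var 0, Var (Suc i)]) [0..<length (incident n ?v)])"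
  have "3 * K \<le> 3 * K * n"
    using n_ge by simp
  then have "9 * K * n + 3 * K \<le> 12 * K * n" by linarith
  with blue_odd[OF v] side_lower_right show ?thesis
    unfolding inst(1)
    by (intro tautological_step[where ks = "[9 * K * n, K]" and As = "[Var 0, ?P]" and B = ?S
          and Xs = "side ?v # map (\<lambda>e. Var (e, Blue)) (incident n ?v)"])
      (use inst in \<open>auto simp: inst_def[of _ 0] K_def comp_def foldr_conj sum_list_triv\<close>)
qed

section \<open>Contradiction between the two summations\<close>

lemma proves_by_nodes: "proves (60 * K * n^2) (Par (by_nodes n))"
proof -
  let ?A = "map (side_edge (n - 1, n - 1)) (incident n (n - 1, n - 1))"
  let ?B = "concat (map (\<lambda>v. map (side_edge v) (incident n v)) (other_nodes n))"
  \<comment> \<open>The cost in \<open>par_concat\<close> for blocks of at most 4 inputs, each shown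
    to be even in \<open>2 * K\<close> lines.\<close>
  let ?k = "length (other_nodes n) * (2 * K + 3 * K * (4 + 2)) + K"
  have len: "length (incident n v) \<le> 4" if "v \<in> set (grid_nodes n)" for v
    using that by (rule length_incident)
  have small: "small (Par (?A @ ?B))"
    using small_by_nodes by (simp add: by_nodes_def)
  have "(n - 1, n - 1) \<in> set (grid_nodes n)"
    using n_ge by (simp add: set_grid_nodes)
  then have "length ?A \<le> 4"
    using len by simp
  then have "3 * K * (length ?A + 1) \<le> 15 * K" by simp
  then have "proves (15 * K) (Neg (Par [Par (by_nodes n), Par ?A, Par ?B]))"
    unfolding by_nodes_def using par_append[OF small] by (rule proves_mono[rotated])
  moreover have "proves ?k (Neg (Par ?B))"
    by (rule par_concat) (use node_sum_even len small_Par_append[OF small] in \<open>auto simp: other_nodes_def\<close>)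
  moreover note node_sum_odd
  moreover have "15 * K + (12 * K * n + ?k) + 3 * K \<le> 60 * K * n^2"
  proof -
    have "length (other_nodes n) \<le> n^2"
      unfolding other_nodes_def using length_filter_le[of _ "grid_nodes n"] by (simp add: length_grid_nodes)
    then have "length (other_nodes n) * (2 * K + 3 * K * (4 + 2)) \<le> n^2 * (2 * K + 3 * K * (4 + 2))"
      by (rule mult_le_mono1)
    also have "\<dots> = 20 * (K * n^2)" by simp
    finally have "?k \<le> 20 * (K * n^2) + K" by linarith
    moreover have "K * n \<le> K * n^2"
      using n_le_M(1) by (rule mult_le_mono2)
    moreover have "K * 4 \<le> K * n^2"
      using power_mono[OF n_ge, of 2] by (intro mult_le_mono2) simp
    ultimately show ?thesis by linarith
  qed
  ultimately show ?thesis
    by (intro tautological_step[where ks = "[15 * K, 12 * K * n, ?k]"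
          and Xs = "[Par (by_nodes n), Par ?A, Par ?B]"
          and As = "[Neg (Par [Var 0, Var 1, Var 2]), Var 1, Neg (Var 2)]" and B = "Var 0"])
      (use small_by_nodes small_Par_append[OF small] in \<open>auto simp: inst_def K_def\<close>)
qed

lemma proves_by_edges: "proves (60 * K * n^3) (Neg (Par (by_edges n)))"
proof (rule proves_mono)
  show "proves (length (grid_edges n) * (9 * K * n + 3 * K * (2 + 2)) + K) (Neg (Par (by_edges n)))"
    unfolding by_edges_def
  proof (rule par_concat)
    show "length (map (\<lambda>v. side_edge v e) (ends e)) \<le> 2" for e
      by (cases e) auto
  qed (use edge_sum small_by_edges in \<open>simp_all add: by_edges_def\<close>)
  have "length (grid_edges n) * (9 * K * n + 3 * K * (2 + 2)) \<le> 2 * n^2 * (9 * K * n + 12 * K)"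
    using length_grid_edges[of n] by (simp add: mult_le_mono1)
  also have "\<dots> = 18 * (K * n^3) + 24 * (K * n^2)"
    by (simp add: algebra_simps power2_eq_square power3_eq_cube)
  finally have "length (grid_edges n) * (9 * K * n + 3 * K * (2 + 2)) \<le> 18 * (K * n^3) + 24 * (K * n^2)" .
  moreover have "K * n^2 \<le> K * n^3" "K \<le> K * n^3"
    using n_le_M(2) n_ge by simp_all
  ultimately show "length (grid_edges n) * (9 * K * n + 3 * K * (2 + 2)) + K \<le> 60 * K * n^3"
    by linarith
qed

text \<open>The same summands have an odd sum node by node and an even sum edge by edge, while
  \<open>par_permute\<close> proves the two sums equal.\<close>

lemma proves_False: "proves (1000 * K * n^4) (Disj [])"
proof -
  \<comment> \<open>Quadratic in a list of at most \<open>4 * n^2\<close> inputs. This permutation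
    is the dominant cost and the source of the exponent 4.\<close>
  let ?k = "9 * K * (length (by_nodes n) + 1)^2"
  have "proves ?k (Neg (Par [Par (by_nodes n), Par (by_edges n)]))"
    by (rule par_permute[OF mset_by_nodes[OF n_ge] small_by_nodes])
  moreover note proves_by_nodes proves_by_edges
  moreover have "60 * K * n^2 + (60 * K * n^3 + ?k) + 3 * K \<le> 1000 * K * n^4"
  proof -
    have le: "n^2 \<le> n^4" "n^3 \<le> n^4" "1 \<le> n^2"
      using n_ge by (auto intro: power_increasing)
    have "length (by_nodes n) \<le> 4 * n^2"
      using mset_eq_length[OF mset_by_nodes[OF n_ge]] length_by_edges[of n] by simp
    with le(3) have "(length (by_nodes n) + 1)^2 \<le> (5 * n^2)^2"
      by (intro power_mono) simp_all
    also have "\<dots> = 25 * n^4"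
      by (simp add: power_mult_distrib flip: power_mult)
    finally have "?k \<le> 9 * K * (25 * n^4)"
      by (rule mult_le_mono2)
    moreover have "K * n^2 \<le> K * n^4" "K * n^3 \<le> K * n^4" "K * 1 \<le> K * n^4"
      using le by (intro mult_le_mono2; linarith)+
    ultimately show ?thesis by linarith
  qed
  ultimately show ?thesis
    by (intro tautological_step[where ks = "[60 * K * n^2, 60 * K * n^3, ?k]"
          and Xs = "[Par (by_nodes n), Par (by_edges n)]"
          and As = "[Var 0, Neg (Var 1), Neg (Par [Var 0, Var 1])]" and B = "Disj []"])
      (use small_by_nodes small_by_edges in \<open>auto simp: inst_def K_def\<close>)
qed

lemma prv_STCONN: "prv (N + 4) (N * M) (1001 * K * n^4) (STCONN n)"
proof -
  \<comment> \<open>An instance of a one-letter tautology, which turns the refutation of the clauses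
    into a proof of their negation.\<close>
  have "prv (N + 4) (N * M) N
      (subst (\<lambda>_. Conj (STCONN_clauses n)) (Imp (Imp (Var (0::nat)) (Disj [])) (Neg (Var 0))))"
    using depth_C symbols_C by (intro tautology_instance) (auto simp: small_def)
  then have *: "prv (N + 4) (N * M) (N + 1000 * K * n^4 + 1) (STCONN n)"
    using proves_False unfolding proves_def STCONN_def by (intro prv_mp) auto
  have "K * 1 \<le> K * n^4"
    using n_ge by (intro mult_le_mono2) simp
  moreover have "N + 1 \<le> K"
    by (simp add: K_def)
  ultimately have "N + 1000 * K * n^4 + 1 \<le> 1001 * K * n^4"
    by linarith
  with * show ?thesis
    by (rule prv_mono)
qed

end

lemma proof_size_le: "(\<And>B. B \<in> set \<pi> \<Longrightarrow> symbols B \<le> m) \<Longrightarrow> proof_size \<pi> \<le> length \<pi> * m"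
  using sum_list_mono[of \<pi> symbols "\<lambda>_. m"] by (simp add: proof_size_def sum_list_triv)

theorem theorem6p1:
  "\<exists>(d::nat) (p::nat poly). \<forall>n\<ge>2. \<exists>\<pi>.
     AC0_2_frege_proof_of d \<pi> (STCONN n) \<and> proof_size \<pi> \<le> poly p n"
proof -
  obtain N0 where N0: "\<And>A :: nat fm. set_fm A \<subseteq> {..<20} \<Longrightarrow> symbols A \<le> 50000 \<Longrightarrow>
      (\<And>v. eval v A) \<Longrightarrow> \<exists>\<pi>. frege_proof \<pi> \<and> \<pi> \<noteq> [] \<and> last \<pi> = A \<and> length \<pi> \<le> N0 \<and>
        (\<forall>B \<in> set \<pi>. depth B \<le> N0 \<and> symbols B \<le> N0)"
    using tautologies_uniform[of 20 50000] by blast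
  \<comment> \<open>The locale asks for \<open>40 \<le> N\<close> as room for single axioms, and
    enlarging a bound is harmless.\<close>
  define N where "N = max N0 40"
  have N: "\<exists>\<pi>. frege_proof \<pi> \<and> \<pi> \<noteq> [] \<and> last \<pi> = A \<and> length \<pi> \<le> N \<and>
      (\<forall>B \<in> set \<pi>. depth B \<le> N \<and> symbols B \<le> N)"
    if A: "set_fm A \<subseteq> {..<20}" "symbols A \<le> 50000" "\<And>v. eval v A" for A :: "nat fm"
  proof -
    obtain \<pi> where "frege_proof \<pi>" "\<pi> \<noteq> []" "last \<pi> = A" "length \<pi> \<le> N0"
      "\<forall>B \<in> set \<pi>. depth B \<le> N0 \<and> symbols B \<le> N0"
      using N0[OF A] by blast
    then show ?thesis
      by (intro exI[of _ \<pi>]) (auto simp: N_def le_max_iff_disj)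
  qed
  \<comment> \<open>The product of at most \<open>1001 * K * n^4\<close> lines, where
    \<open>K\<close> is \<open>N + 100000\<close>, and at most \<open>N * (20000 * n^3)\<close>
    symbols per line.\<close>
  let ?p = "monom (1001 * (N + 100000) * (N * 20000)) 7 :: nat poly"
  have "\<exists>\<pi>. AC0_2_frege_proof_of (N + 4) \<pi> (STCONN n) \<and> proof_size \<pi> \<le> poly ?p n"
    if n: "2 \<le> n" for n
  proof -
    have "10000 * n^2 \<le> 20000 * n^3"
      using n by (simp add: power2_eq_square power3_eq_cube)
    then have "symbols (Conj (STCONN_clauses n)) \<le> 20000 * n^3"
      using symbols_STCONN_clauses[OF n] by linarith
    then interpret stconn N "20000 * n^3" n
      using N n depth_STCONN_clauses[of n] by unfold_locales (auto simp: N_def)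
    obtain \<pi> where \<pi>: "frege_proof \<pi>" "\<pi> \<noteq> []" "last \<pi> = STCONN n" "length \<pi> \<le> 1001 * K * n^4"
      "\<forall>B \<in> set \<pi>. depth B \<le> N + 4 \<and> symbols B \<le> N * (20000 * n^3)"
      using prv_STCONN unfolding prv_def by blast
    have "proof_size \<pi> \<le> length \<pi> * (N * (20000 * n^3))"
      using \<pi>(5) by (intro proof_size_le) simp
    also have "\<dots> \<le> 1001 * K * n^4 * (N * (20000 * n^3))"
      using \<pi>(4) by (rule mult_le_mono1)
    also have "\<dots> = poly ?p n"
      by (simp add: poly_monom K_def algebra_simps flip: power_add)
    finally show ?thesis
      using \<pi> by (auto simp: AC0_2_frege_proof_of_def)
  qed
  then show ?thesis by blast
qed

end
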